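(* Let $p\geq 2$ and let $G$ be a finite simple $\{pK_2, \mathrm{gem}^+\}$-free graph. Then $\chi(G)\leq f_p(\omega(G))$, where $f_p:\mathbb{N}\to\mathbb{N}$ ($p\geq2$) is defined by: $f_t(1)=1$ for $t\geq2$; $f_2(2)=3$; $f_2(3)=4$; $f_2(s)=\binom{s+1}{2}$ for $s\geq 4$; $f_p(2)=2p-2$ for $p\geq 3$; and $f_p(m)=f_{p-1}(m)+\binom{m+1}{2}+m-2$ for $m,p\geq 3$.
   Context: $\chi(G)$ is the chromatic number and $\omega(G)$ the clique number of $G$. $pK_2$ is the disjoint union of $p$ edges. $\mathrm{gem}^+$ is the graph on six vertices $K_1+(P_4\cup K_1)$: a vertex adjacent to all vertices of a path $P_4$ and to one further vertex, the latter having no other neighbours (i.e. a gem with a pendant vertex attached to its dominating vertex). A graph is $\mathcal{F}$-free if it has no induced subgraph isomorphic to a member of $\mathcal{F}$. *)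

theory Defs
  imports "Graph_Theory.Graph_Theory"
begin

text \<open>A finite simple graph is a \<^const>\<open>pair_graph\<close>: a finite vertex set with a symmetric,
  irreflexive set of ordered pairs, so each edge $uv$ is stored as both $(u,v)$ and $(v,u)$.\<close>

definition proper_coloring :: "'a pair_pre_digraph \<Rightarrow> nat \<Rightarrow> ('a \<Rightarrow> nat) \<Rightarrow> bool" where
  "proper_coloring G k c \<longleftrightarrow>
     c ` pverts G \<subseteq> {..<k} \<and> (\<forall>(u, v) \<in> parcs G. c u \<noteq> c v)"

definition chromatic_number :: "'a pair_pre_digraph \<Rightarrow> nat" where
  "chromatic_number G = (LEAST k. \<exists>c. proper_coloring G k c)"

definition is_clique :: "'a pair_pre_digraph \<Rightarrow> 'a set \<Rightarrow> bool" where
  "is_clique G K \<longleftrightarrow> K \<subseteq> pverts G \<and> pairwise (\<lambda>u v. (u, v) \<in> parcs G) K"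

definition clique_number :: "'a pair_pre_digraph \<Rightarrow> nat" where
  "clique_number G = Max (card ` {K. is_clique G K})"

definition free_of :: "'b pair_pre_digraph set \<Rightarrow> 'a pair_pre_digraph \<Rightarrow> bool" where
  "free_of \<F> G \<longleftrightarrow>
     \<not> (\<exists>F \<in> \<F>. \<exists>H. induced_subgraph H (with_proj G) \<and> digraph_iso H (with_proj F))"

definition disjoint_edges :: "nat \<Rightarrow> nat pair_pre_digraph" where
  "disjoint_edges p =
     \<lparr> pverts = {..<2 * p}, parcs = symcl ((\<lambda>i. (2 * i, 2 * i + 1)) ` {..<p}) \<rparr>"

text \<open>0 is the dominating vertex, 1-2-3-4 the path, and 5 the pendant vertex.\<close>

definition gem_plus :: "nat pair_pre_digraph" where
  "gem_plus =
     \<lparr> pverts = {0, 1, 2, 3, 4, 5},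
       parcs = symcl {(1, 2), (2, 3), (3, 4), (0, 1), (0, 2), (0, 3), (0, 4), (0, 5)} \<rparr>"

text \<open>The value 0 outside the intended domain (first argument at least 2, second at least 1)
  is a convention; a second argument 0 arises only for the graph without vertices.\<close>

fun chi_bound :: "nat \<Rightarrow> nat \<Rightarrow> nat" where
  "chi_bound p m =
     (if p < 2 \<or> m = 0 then 0
      else if m = 1 then 1
      else if p = 2 then (if m = 2 then 3 else if m = 3 then 4 else (m + 1) choose 2)
      else if m = 2 then 2 * p - 2
      else chi_bound (p - 1) m + ((m + 1) choose 2) + m - 2)"

declare chi_bound.simps [simp del]

lemma chi_bound_eqs:
  "2 \<le> t \<Longrightarrow> chi_bound t 1 = 1"
  "chi_bound 2 2 = 3"
  "chi_bound 2 3 = 4"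
  "4 \<le> s \<Longrightarrow> chi_bound 2 s = (s + 1) choose 2"
  "3 \<le> p \<Longrightarrow> chi_bound p 2 = 2 * p - 2"
  "3 \<le> m \<Longrightarrow> 3 \<le> p \<Longrightarrow> chi_bound p m = chi_bound (p - 1) m + ((m + 1) choose 2) + m - 2"
  by (simp_all add: chi_bound.simps[of t] chi_bound.simps[of 2] chi_bound.simps[of p]
        del: One_nat_def)

lemma pair_graph_disjoint_edges: "pair_graph (disjoint_edges p)"
  by unfold_locales
    (auto simp: disjoint_edges_def symcl_def symmetric_def arcs_ends_conv with_proj_def sym_def)

lemma pair_graph_gem_plus: "pair_graph gem_plus"
  by unfold_locales
    (auto simp: gem_plus_def symcl_def symmetric_def arcs_ends_conv with_proj_def sym_def)

lemma free_of_iff_embedding: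
  assumes G: "pair_graph G" and \<F>: "\<And>F. F \<in> \<F> \<Longrightarrow> pair_graph F"
  shows "free_of \<F> G \<longleftrightarrow>
    \<not> (\<exists>F \<in> \<F>. \<exists>f. inj_on f (pverts F) \<and> f ` pverts F \<subseteq> pverts G \<and>
        (\<forall>u \<in> pverts F. \<forall>v \<in> pverts F. (f u, f v) \<in> parcs G \<longleftrightarrow> (u, v) \<in> parcs F))"
proof -
  interpret G: pair_graph G by (rule G)
  have "(\<exists>H. induced_subgraph H (with_proj G) \<and> digraph_iso H (with_proj F)) \<longleftrightarrow>
     (\<exists>f. inj_on f (pverts F) \<and> f ` pverts F \<subseteq> pverts G \<and>
        (\<forall>u \<in> pverts F. \<forall>v \<in> pverts F. (f u, f v) \<in> parcs G \<longleftrightarrow> (u, v) \<in> parcs F))"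
    (is "?L \<longleftrightarrow> ?R") if "F \<in> \<F>" for F
  proof
    interpret F: pair_graph F by (rule \<F>[OF that])
    {
      assume ?L
      then obtain H h where H: "induced_subgraph H (with_proj G)"
        and h: "pre_digraph.digraph_isomorphism H h" "with_proj F = app_iso h H"
        unfolding digraph_iso_def by blast
      let ?g = "iso_verts h"
      have th: "tail H = fst" "head H = snd" and VH: "verts H \<subseteq> pverts G"
        and AH: "arcs H = {e \<in> parcs G. fst e \<in> verts H \<and> snd e \<in> verts H}"
        using H by (auto simp: induced_subgraph_def subgraph_def compatible_def)
      have inj: "inj_on ?g (verts H)"
        and ends: "\<And>a. a \<in> arcs H \<Longrightarrow> ?g (fst a) = fst (iso_arcs h a) \<and> ?g (snd a) = snd (iso_arcs h a)"
        using h th by (auto simp: pre_digraph.digraph_isomorphism_def app_iso_def with_proj_def)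
      have VF: "pverts F = ?g ` verts H" and AF: "parcs F = iso_arcs h ` arcs H"
        using h(2) by (auto simp: app_iso_def with_proj_def)
      have ia: "iso_arcs h a = (?g (fst a), ?g (snd a))" if "a \<in> arcs H" for a
        using ends[OF that] by (simp add: prod_eq_iff)
      have iff: "(?g x, ?g y) \<in> parcs F \<longleftrightarrow> (x, y) \<in> parcs G" if xy: "x \<in> verts H" "y \<in> verts H" for x y
      proof
        assume "(?g x, ?g y) \<in> parcs F"
        then obtain a where a: "a \<in> arcs H" "(?g x, ?g y) = iso_arcs h a" using AF by auto
        then have "x = fst a" "y = snd a"
          using ia[OF a(1)] inj xy AH by (auto simp: inj_on_def)
        then show "(x, y) \<in> parcs G" using a(1) AH by simp
      next
        assume "(x, y) \<in> parcs G"
        then have "(x, y) \<in> arcs H" using AH xy by simp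
        then show "(?g x, ?g y) \<in> parcs F" using ia[of "(x, y)"] AF by force
      qed
      let ?f = "the_inv_into (verts H) ?g"
      have f: "?f u \<in> verts H \<and> ?g (?f u) = u" if "u \<in> pverts F" for u
        using that inj VF by (auto simp: the_inv_into_f_f)
      show ?R
      proof (intro exI[of _ ?f] conjI ballI)
        show "inj_on ?f (pverts F)" using f by (metis inj_onI)
        show "?f ` pverts F \<subseteq> pverts G" using f VH by blast
        show "(?f u, ?f v) \<in> parcs G \<longleftrightarrow> (u, v) \<in> parcs F" if "u \<in> pverts F" "v \<in> pverts F" for u v
          using iff[of "?f u" "?f v"] f that by auto
      qed
    next
      assume ?R
      then obtain f where inj: "inj_on f (pverts F)" and sub: "f ` pverts F \<subseteq> pverts G"
        and iff: "\<And>u v. u \<in> pverts F \<Longrightarrow> v \<in> pverts F \<Longrightarrow> (f u, f v) \<in> parcs G \<longleftrightarrow> (u, v) \<in> parcs F"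
        by blast
      let ?H = "with_proj G \<restriction> (f ` pverts F)"
      let ?g = "the_inv_into (pverts F) f"
      let ?h = "\<lparr> iso_verts = ?g, iso_arcs = map_prod ?g ?g, iso_head = snd, iso_tail = fst \<rparr>"
      have gf: "?g (f u) = u" if "u \<in> pverts F" for u using inj that by (rule the_inv_into_f_f)
      have ig: "inj_on ?g (f ` pverts F)" using gf by (auto simp: inj_on_def)
      have wfH: "wf_digraph ?H" by (rule G.wellformed_induce_subgraph)
      have 1: "induced_subgraph ?H (with_proj G)" using sub by (intro G.induced_induce) auto
      have "inj_on (map_prod ?g ?g) (arcs ?H)"
        using gf by (auto simp: inj_on_def)
      then have 2: "pre_digraph.digraph_isomorphism ?H ?h"
        using ig wfH by (auto simp: pre_digraph.digraph_isomorphism_def)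
      have "parcs F = map_prod ?g ?g ` arcs ?H"
      proof (intro equalityI subsetI)
        fix e assume e: "e \<in> parcs F"
        obtain u v where uv: "e = (u, v)" by (cases e)
        have "u \<in> pverts F" "v \<in> pverts F" using e uv F.wellformed' by auto
        then show "e \<in> map_prod ?g ?g ` arcs ?H"
          using e uv iff gf by (intro image_eqI[of _ _ "(f u, f v)"]) auto
      next
        fix e assume "e \<in> map_prod ?g ?g ` arcs ?H"
        then show "e \<in> parcs F" using iff gf by auto
      qed
      moreover have "pverts F = ?g ` f ` pverts F" using gf by (auto simp: image_iff)
      ultimately have "with_proj F = app_iso ?h ?H" by (simp add: app_iso_def with_proj_def)
      then show ?L using 1 2 unfolding digraph_iso_def by blast
    }
  qed
  then show ?thesis unfolding free_of_def by (simp only: cong: bex_cong)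
qed

end

theory Submission
  imports Defs
begin

text \<open>
  Let \<open>uv\<close> be an edge of a graph \<open>G\<close> with clique number \<open>m\<close>. The vertex \<open>v\<close> has no neighbour in
  \<open>N(u) - N[v]\<close>, so a \<open>P\<^sub>4\<close> there would form a \<open>gem\<^sup>+\<close> together with \<open>u\<close> and \<open>v\<close>; hence \<open>N(u) - N(v)\<close>
  and \<open>N(v) - N(u)\<close> are \<open>P\<^sub>4\<close>-free and need at most \<open>m - 1\<close> colours each. The common
  neighbourhood is \<open>(P\<^sub>4 \<union> K\<^sub>1)\<close>-free with clique number at most \<open>m - 2\<close>, and splitting it repeatedly into
  neighbours and non-neighbours of a vertex colours it with \<open>m - 1\<close> choose 2 colours. The
  common non-neighbours contain no induced \<open>(p - 1)K\<^sub>2\<close>, which gives an induction on \<open>p\<close>.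

  Two cases need sharper bounds: \<open>2K\<^sub>2\<close>-free graphs with \<open>m = 3\<close> and triangle-free \<open>3K\<^sub>2\<close>-free graphs
  are 4-colourable. Both follow the same pattern. If \<open>G\<close> contains a suitable small configuration, then
  colouring each vertex by its adjacencies to the configuration is proper, because an edge inside
  a colour class would complete a forbidden subgraph with vertices of the configuration; once these
  configurations are excluded, a coarser colouring works.
\<close>

section \<open>Colourings and cliques\<close>

text \<open>A graph is a relation \<open>E\<close> on the whole type together with a vertex set
  \<open>V\<close>, so that an induced subgraph is obtained by shrinking \<open>V\<close>
  alone.\<close>

definition colorable :: "('a \<Rightarrow> 'a \<Rightarrow> bool) \<Rightarrow> 'a set \<Rightarrow> nat \<Rightarrow> bool" where
  "colorable E V k \<longleftrightarrow>
     (\<exists>c :: 'a \<Rightarrow> nat. (\<forall>v \<in> V. c v < k) \<and> (\<forall>u \<in> V. \<forall>v \<in> V. E u v \<longrightarrow> c u \<noteq> c v))"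

text \<open>An upper bound instead of the clique number itself, so that it passes to every subset.
  Since \<open>card\<close> is 0 on infinite sets, only finite cliques are restricted.\<close>

definition cliques_le :: "('a \<Rightarrow> 'a \<Rightarrow> bool) \<Rightarrow> 'a set \<Rightarrow> nat \<Rightarrow> bool" where
  "cliques_le E V m \<longleftrightarrow> (\<forall>K \<subseteq> V. pairwise E K \<longrightarrow> card K \<le> m)"

text \<open>In the following conditions the listed adjacencies and non-adjacencies force the vertices
  to be distinct.\<close>

definition P4_free :: "('a \<Rightarrow> 'a \<Rightarrow> bool) \<Rightarrow> 'a set \<Rightarrow> bool" where
  "P4_free E V \<longleftrightarrow> (\<forall>a \<in> V. \<forall>b \<in> V. \<forall>c \<in> V. \<forall>d \<in> V.
     E a b \<longrightarrow> E b c \<longrightarrow> E c d \<longrightarrow> E a c \<or> E a d \<or> E b d)"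

definition P4_plus_K1_free :: "('a \<Rightarrow> 'a \<Rightarrow> bool) \<Rightarrow> 'a set \<Rightarrow> bool" where
  "P4_plus_K1_free E V \<longleftrightarrow> (\<forall>v \<in> V. P4_free E {w \<in> V. \<not> E v w})"

definition gem_plus_free :: "('a \<Rightarrow> 'a \<Rightarrow> bool) \<Rightarrow> 'a set \<Rightarrow> bool" where
  "gem_plus_free E V \<longleftrightarrow> (\<forall>v \<in> V. P4_plus_K1_free E {w \<in> V. E v w})"

definition induced_matching :: "('a \<Rightarrow> 'a \<Rightarrow> bool) \<Rightarrow> 'a set \<Rightarrow> nat \<Rightarrow> bool" where
  "induced_matching E V p \<longleftrightarrow> (\<exists>f g. (\<forall>i<p. f i \<in> V \<and> g i \<in> V \<and> E (f i) (g i)) \<and>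
     (\<forall>i<p. \<forall>j<p. i \<noteq> j \<longrightarrow> \<not> E (f i) (f j) \<and> \<not> E (f i) (g j) \<and> \<not> E (g i) (f j) \<and> \<not> E (g i) (g j)))"

lemma colorable_mono:
  assumes "colorable E V k" "W \<subseteq> V" "k \<le> l"
  shows "colorable E W l"
proof -
  obtain c where "\<forall>v \<in> V. c v < k" "\<forall>u \<in> V. \<forall>v \<in> V. E u v \<longrightarrow> c u \<noteq> c v"
    using assms(1) unfolding colorable_def by blast
  then show ?thesis
    unfolding colorable_def using assms(2,3) by (intro exI[of _ c]) fastforce
qed

lemma colorable_Un:
  assumes "colorable E V k" "colorable E W l"
  shows "colorable E (V \<union> W) (k + l)"
proof -
  obtain c d where c: "\<forall>v \<in> V. c v < k" "\<forall>u \<in> V. \<forall>v \<in> V. E u v \<longrightarrow> c u \<noteq> c v"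
    and d: "\<forall>v \<in> W. d v < l" "\<forall>u \<in> W. \<forall>v \<in> W. E u v \<longrightarrow> d u \<noteq> d v"
    using assms unfolding colorable_def by blast
  let ?c = "\<lambda>v. if v \<in> V then c v else k + d v"
  have "\<forall>v \<in> V \<union> W. ?c v < k + l" using c(1) d(1) by (auto intro: trans_less_add1)
  moreover have "?c u \<noteq> ?c v" if "u \<in> V \<union> W" "v \<in> V \<union> W" "E u v" for u v
  proof -
    have "c w < k" if "w \<in> V" for w using c(1) that by blast
    moreover have "u \<in> W" if "u \<notin> V" using \<open>u \<in> V \<union> W\<close> that by blast
    moreover have "v \<in> W" if "v \<notin> V" using \<open>v \<in> V \<union> W\<close> that by blast
    ultimately show ?thesis
      using c(2) d(2) \<open>E u v\<close> by (smt (verit) add_left_cancel not_add_less1)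
  qed
  ultimately show ?thesis unfolding colorable_def by (intro exI[of _ ?c]) blast
qed

lemma colorable_stable: "(\<And>u v. u \<in> V \<Longrightarrow> v \<in> V \<Longrightarrow> \<not> E u v) \<Longrightarrow> colorable E V 1"
  unfolding colorable_def by (intro exI[of _ "\<lambda>_. 0"]) auto

text \<open>A colour is a pair of truth values; this turns properness into a propositional condition
  on adjacencies.\<close>

lemma colorable4_bits:
  fixes p q :: "'a \<Rightarrow> bool"
  assumes "\<And>u v. E u v \<Longrightarrow> p u \<noteq> p v \<or> q u \<noteq> q v"
  shows "colorable E UNIV 4"
  unfolding colorable_def
proof (intro exI conjI ballI impI)
  let ?c = "\<lambda>v. (if p v then 2 else 0) + (if q v then 1 else (0::nat))"
  show "?c v < 4" for v by simp
  show "?c u \<noteq> ?c v" if "E u v" for u v using assms[OF that] by auto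
qed

lemma cliques_le_subset: "cliques_le E V m \<Longrightarrow> W \<subseteq> V \<Longrightarrow> cliques_le E W m"
  unfolding cliques_le_def by blast

lemma cliques_le_0: "cliques_le E V 0 \<longleftrightarrow> V = {}"
proof
  assume *: "cliques_le E V 0"
  show "V = {}"
  proof (rule ccontr)
    assume "V \<noteq> {}"
    then obtain v where "{v} \<subseteq> V" by blast
    moreover have "pairwise E {v}" by simp
    ultimately have "card {v} \<le> 0" using * unfolding cliques_le_def by blast
    then show False by simp
  qed
qed (simp add: cliques_le_def)

lemma P4_free_subset: "P4_free E V \<Longrightarrow> W \<subseteq> V \<Longrightarrow> P4_free E W"
  unfolding P4_free_def by blast

lemma P4_plus_K1_free_subset:
  assumes "P4_plus_K1_free E V" "W \<subseteq> V"
  shows "P4_plus_K1_free E W"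
  unfolding P4_plus_K1_free_def
proof
  fix v assume "v \<in> W"
  then have "P4_free E {w \<in> V. \<not> E v w}" using assms unfolding P4_plus_K1_free_def by (simp add: subset_iff)
  then show "P4_free E {w \<in> W. \<not> E v w}" by (rule P4_free_subset) (use assms(2) in blast)
qed

lemma gem_plus_free_subset:
  assumes "gem_plus_free E V" "W \<subseteq> V"
  shows "gem_plus_free E W"
  unfolding gem_plus_free_def
proof
  fix v assume "v \<in> W"
  then have "P4_plus_K1_free E {w \<in> V. E v w}" using assms unfolding gem_plus_free_def by (simp add: subset_iff)
  then show "P4_plus_K1_free E {w \<in> W. E v w}" by (rule P4_plus_K1_free_subset) (use assms(2) in blast)
qed

section \<open>Graphs without \<open>P\<^sub>4\<close>, \<open>P\<^sub>4 + K\<^sub>1\<close> or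
  large induced matchings\<close>

locale ugraph =
  fixes E :: "'a \<Rightarrow> 'a \<Rightarrow> bool"
  assumes sym: "E u v \<Longrightarrow> E v u" and irrefl: "\<not> E u u"
begin

lemma cliques_le_neighbours:
  assumes "finite V" "v \<in> V" "cliques_le E V (Suc m)"
  shows "cliques_le E {w \<in> V. E v w} m"
  unfolding cliques_le_def
proof (intro allI impI)
  fix K assume K: "K \<subseteq> {w \<in> V. E v w}" "pairwise E K"
  then have "pairwise E (insert v K)" using sym by (auto simp: pairwise_insert)
  moreover have "insert v K \<subseteq> V" "v \<notin> K" "finite K"
    using K assms(1,2) irrefl by (auto intro: finite_subset)
  ultimately show "card K \<le> m" using assms(3) unfolding cliques_le_def
    by (metis Suc_le_mono card_insert_disjoint)
qed

text \<open>A maximal stable set of a \<open>P\<^sub>4\<close>-free graph meets every maximum clique.\<close>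

lemma P4_free_colorable:
  assumes "finite V" "P4_free E V" "cliques_le E V w"
  shows "colorable E V w"
  using assms
proof (induction w arbitrary: V)
  case 0
  then show ?case by (simp add: colorable_def cliques_le_0)
next
  case (Suc w)
  let ?st = "{S. S \<subseteq> V \<and> (\<forall>u \<in> S. \<forall>v \<in> S. \<not> E u v)}"
  have "finite ?st" by (rule finite_subset[of _ "Pow V"]) (use Suc.prems(1) in auto)
  moreover have "?st \<noteq> {}" by blast
  ultimately obtain S where S: "S \<in> ?st" and "\<forall>T \<in> ?st. S \<subseteq> T \<longrightarrow> S = T"
    using finite_has_maximal[of ?st] by auto
  then have Smax: "S = T" if "T \<in> ?st" "S \<subseteq> T" for T using that by blast
  have dom: "\<exists>s \<in> S. E v s" if "v \<in> V - S" for v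
  proof (rule ccontr)
    assume "\<not> ?thesis"
    then have *: "\<not> E v s" "\<not> E s v" if "s \<in> S" for s using sym[of s v] that by blast+
    have "\<not> E x y" if "x \<in> insert v S" "y \<in> insert v S" for x y
      using that * S irrefl[of v] by blast
    then have "insert v S \<in> ?st" using S \<open>v \<in> V - S\<close> by blast
    then show False using Smax[of "insert v S"] \<open>v \<in> V - S\<close> by blast
  qed
  have "cliques_le E (V - S) w"
    unfolding cliques_le_def
  proof (intro allI impI, rule ccontr)
    fix K assume K: "K \<subseteq> V - S" "pairwise E K" and "\<not> card K \<le> w"
    have finK: "finite K" using K(1) Suc.prems(1) by (meson Diff_subset finite_subset)
    \<comment> \<open>\<open>K\<close> has at least \<open>w + 1\<close> vertices, so it cannot be
      enlarged.\<close>
    have maxK: "\<exists>k \<in> K. \<not> E s k" if "s \<in> V - K" for s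
    proof (rule ccontr)
      assume "\<not> ?thesis"
      then have "pairwise E (insert s K)" using K(2) by (auto simp: pairwise_insert intro: sym)
      moreover have "insert s K \<subseteq> V" using K(1) that by blast
      ultimately have "card (insert s K) \<le> Suc w" using Suc.prems(3) unfolding cliques_le_def by blast
      then show False using finK that \<open>\<not> card K \<le> w\<close> by simp
    qed
    have "K \<noteq> {}" using \<open>\<not> card K \<le> w\<close> by auto
    then have "S \<noteq> {}" using dom K(1) by blast
    have finS: "finite S" using S Suc.prems(1) by (auto intro: finite_subset)
    \<comment> \<open>Choose \<open>s\<close> in \<open>S\<close> with the most neighbours in
      \<open>K\<close>. It misses some \<open>k\<close> in \<open>K\<close>, and \<open>k\<close>
      has a neighbour \<open>t\<close> in \<open>S\<close>. By the choice of \<open>s\<close>, some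
      \<open>l\<close> in \<open>K\<close> sees \<open>s\<close> but not \<open>t\<close>, and then
      \<open>s l k t\<close> is an induced \<open>P\<^sub>4\<close>.\<close>
    let ?n = "\<lambda>s. card {k \<in> K. E s k}"
    have "Max (?n ` S) \<in> ?n ` S" using finS \<open>S \<noteq> {}\<close> by (intro Max_in) auto
    then obtain s where s: "s \<in> S" and "Max (?n ` S) = ?n s" by blast
    then have smax: "?n t \<le> ?n s" if "t \<in> S" for t
      using Max_ge[of "?n ` S" "?n t"] that finS by simp
    obtain k where k: "k \<in> K" "\<not> E s k" using maxK s S K(1) by blast
    obtain t where t: "t \<in> S" "E k t" using dom k(1) K(1) by blast
    have "\<exists>l. l \<in> K \<and> E s l \<and> \<not> E t l"
    proof (rule ccontr)
      assume "\<not> ?thesis"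
      then have "{k \<in> K. E s k} \<subseteq> {k \<in> K. E t k}" by blast
      moreover have "k \<in> {k \<in> K. E t k}" "k \<notin> {k \<in> K. E s k}" using k t sym[of k t] by auto
      ultimately have "{k \<in> K. E s k} \<subset> {k \<in> K. E t k}" by blast
      then have "?n s < ?n t" by (rule psubset_card_mono[rotated]) (use finK in auto)
      then show False using smax[OF t(1)] by simp
    qed
    then obtain l where l: "l \<in> K" "E s l" "\<not> E t l" by blast
    have "E l k" using K(2) k l by (auto simp: pairwise_def)
    moreover have "\<not> E s t" "\<not> E l t" using s t S l sym[of l t] by blast+
    moreover have "s \<in> V" "l \<in> V" "k \<in> V" "t \<in> V" using s l k t S K(1) by auto
    ultimately show False using Suc.prems(2) l k t unfolding P4_free_def by blast
  qed
  moreover have "P4_free E (V - S)" using Suc.prems(2) unfolding P4_free_def by blast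
  ultimately have "colorable E (V - S) w" using Suc.IH Suc.prems(1) by simp
  moreover have "colorable E S 1" using S by (intro colorable_stable) auto
  ultimately have "colorable E ((V - S) \<union> S) (w + 1)" by (rule colorable_Un)
  moreover have "(V - S) \<union> S = V" using S by blast
  ultimately show ?case by simp
qed

text \<open>The non-neighbours of a vertex are \<open>P\<^sub>4\<close>-free and take
  \<open>w\<close> colours, its neighbours have smaller cliques, and the two counts add up by
  Pascal's rule.\<close>

lemma P4_plus_K1_free_colorable:
  assumes "finite V" "P4_plus_K1_free E V" "cliques_le E V w"
  shows "colorable E V (Suc w choose 2)"
  using assms
proof (induction w arbitrary: V)
  case 0
  then show ?case by (simp add: colorable_def cliques_le_0)
next
  case (Suc w)
  show ?case
  proof (cases "V = {}")
    case True
    then show ?thesis by (simp add: colorable_def)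
  next
    case False
    then obtain v where v: "v \<in> V" by blast
    let ?N = "{u \<in> V. E v u}" and ?M = "{u \<in> V. \<not> E v u}"
    have "P4_plus_K1_free E ?N" using Suc.prems(2) by (rule P4_plus_K1_free_subset) auto
    then have N: "colorable E ?N (Suc w choose 2)"
      using Suc.IH[of ?N] Suc.prems cliques_le_neighbours[OF Suc.prems(1) v] by simp
    have "cliques_le E ?M (Suc w)" using Suc.prems(3) by (rule cliques_le_subset) auto
    moreover have "P4_free E ?M" using Suc.prems(2) v unfolding P4_plus_K1_free_def by blast
    ultimately have "colorable E ?M (Suc w)" using P4_free_colorable Suc.prems(1) by simp
    from colorable_Un[OF N this] have "colorable E (?N \<union> ?M) (Suc (Suc w) choose 2)"
      by (simp add: numeral_2_eq_2 ac_simps)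
    then show ?thesis by (rule colorable_mono) auto
  qed
qed

text \<open>Read contrapositively, this drives the induction on \<open>p\<close>: the common
  non-neighbours of an edge have no induced matching of size one less.\<close>

lemma induced_matching_Suc:
  assumes "u \<in> V" "v \<in> V" "E u v" "induced_matching E {w \<in> V. \<not> E u w \<and> \<not> E v w} p"
  shows "induced_matching E V (Suc p)"
proof -
  obtain f g where *: "\<forall>i<p. f i \<in> {w \<in> V. \<not> E u w \<and> \<not> E v w} \<and> g i \<in> {w \<in> V. \<not> E u w \<and> \<not> E v w} \<and> E (f i) (g i)"
    "\<forall>i<p. \<forall>j<p. i \<noteq> j \<longrightarrow> \<not> E (f i) (f j) \<and> \<not> E (f i) (g j) \<and> \<not> E (g i) (f j) \<and> \<not> E (g i) (g j)"
    using assms(4) unfolding induced_matching_def by (elim exE conjE)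
  let ?f = "f(p := u)" and ?g = "g(p := v)"
  have **: "\<forall>i<Suc p. ?f i \<in> V \<and> ?g i \<in> V \<and> E (?f i) (?g i)"
    using * assms(1-3) by (auto simp: less_Suc_eq)
  have "\<not> E (f i) u \<and> \<not> E (f i) v \<and> \<not> E (g i) u \<and> \<not> E (g i) v" if "i < p" for i
    using *(1) that sym[of "f i"] sym[of "g i"] by blast
  with * have "\<forall>i<Suc p. \<forall>j<Suc p. i \<noteq> j \<longrightarrow>
      \<not> E (?f i) (?f j) \<and> \<not> E (?f i) (?g j) \<and> \<not> E (?g i) (?f j) \<and> \<not> E (?g i) (?g j)"
    by (auto simp: less_Suc_eq)
  with ** show ?thesis
    unfolding induced_matching_def by (intro exI[of _ ?f] exI[of _ ?g] conjI)
qed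

text \<open>The clique bound is \<open>m + 2\<close>, so it is \<open>m\<close> on the common
  neighbourhood \<open>?A\<close> and \<open>m + 1\<close> on each of \<open>?B\<close> and
  \<open>?C\<close>, which contain \<open>v\<close> and \<open>u\<close> respectively.\<close>

lemma colorable_edge_step:
  assumes "finite V" "gem_plus_free E V" "cliques_le E V (Suc (Suc m))"
    and uv: "u \<in> V" "v \<in> V" "E u v"
    and H: "colorable E {w \<in> V. \<not> E u w \<and> \<not> E v w} h"
  shows "colorable E V (h + (Suc m choose 2) + 2 * Suc m)"
proof -
  let ?A = "{w \<in> V. E u w \<and> E v w}" and ?B = "{w \<in> V. E u w \<and> \<not> E v w}"
    and ?C = "{w \<in> V. E v w \<and> \<not> E u w}" and ?H = "{w \<in> V. \<not> E u w \<and> \<not> E v w}"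
  have N: "P4_plus_K1_free E {w \<in> V. E x w}" if "x \<in> V" for x
    using assms(2) that unfolding gem_plus_free_def by blast
  have cl: "cliques_le E {w \<in> V. E x w} (Suc m)" if "x \<in> V" for x
    using cliques_le_neighbours[OF assms(1) that assms(3)] .
  have "v \<in> {w \<in> V. E u w}" "u \<in> {w \<in> V. E v w}" using uv sym by auto
  \<comment> \<open>Inside the neighbourhood of \<open>u\<close> the vertex \<open>v\<close> acts as
    the \<open>K\<^sub>1\<close>, and symmetrically.\<close>
  then have "P4_free E {w \<in> {w \<in> V. E u w}. \<not> E v w}" "P4_free E {w \<in> {w \<in> V. E v w}. \<not> E u w}"
    using N uv unfolding P4_plus_K1_free_def by blast+
  moreover have "{w \<in> {w \<in> V. E u w}. \<not> E v w} = ?B" "{w \<in> {w \<in> V. E v w}. \<not> E u w} = ?C" by auto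
  moreover have "cliques_le E ?B (Suc m)" "cliques_le E ?C (Suc m)"
    using cliques_le_subset[OF cl[OF uv(1)], of ?B] cliques_le_subset[OF cl[OF uv(2)], of ?C] by auto
  ultimately have B: "colorable E ?B (Suc m)" and C: "colorable E ?C (Suc m)"
    using P4_free_colorable assms(1) by simp_all
  have "cliques_le E {w \<in> {w \<in> V. E u w}. E v w} m"
    using cliques_le_neighbours[of "{w \<in> V. E u w}" v m] cl[OF uv(1)] uv assms(1) by simp
  moreover have "{w \<in> {w \<in> V. E u w}. E v w} = ?A" by auto
  ultimately have "cliques_le E ?A m" by simp
  moreover have "P4_plus_K1_free E ?A" using N[OF uv(1)] by (rule P4_plus_K1_free_subset) auto
  ultimately have "colorable E ?A (Suc m choose 2)"
    using P4_plus_K1_free_colorable assms(1) by simp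
  from colorable_Un[OF colorable_Un[OF H this] colorable_Un[OF B C]]
  have "colorable E (?H \<union> ?A \<union> (?B \<union> ?C)) (h + (Suc m choose 2) + (Suc m + Suc m))" .
  then show ?thesis by (rule colorable_mono) auto
qed

end

section \<open>\<open>2K\<^sub>2\<close>-free graphs with clique number three\<close>

text \<open>The forbidden subgraphs are clauses about adjacency alone. Taking all four vertices of
  \<open>k4\<close> equal excludes loops. In \<open>gem\<close> the dominating vertex is
  \<open>a\<close>, the path is \<open>b c d e\<close> and the pendant vertex is
  \<open>f\<close>.\<close>

locale two_K2_K4_gem_plus_free =
  fixes E :: "'a \<Rightarrow> 'a \<Rightarrow> bool"
  assumes commute: "E x y \<longleftrightarrow> E y x"
    and k4: "\<not> E a b \<or> \<not> E a c \<or> \<not> E a d \<or> \<not> E b c \<or> \<not> E b d \<or> \<not> E c d"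
    and two: "\<not> E a b \<or> E a c \<or> E a d \<or> E b c \<or> E b d \<or> \<not> E c d"
    and gem: "\<not> E a b \<or> \<not> E a c \<or> \<not> E a d \<or> \<not> E a e \<or> \<not> E a f \<or>
      \<not> E b c \<or> E b d \<or> E b e \<or> E b f \<or> \<not> E c d \<or> E c e \<or> E c f \<or>
      \<not> E d e \<or> E d f \<or> E e f"
begin

text \<open>The configurations and colourings below come from a computer search, which also selected the
  instances of the hypotheses that refute a monochromatic edge \<open>uv\<close>. The two bits \<open>?p\<close>, \<open>?q\<close> encode
  the colour.\<close>

lemma colorable_if_five_cycle_ext1:
  assumes "E a b" "E a e" "E a f" "E b c" "E b g" "E c d" "E c f" "E c g" "E d e" "E d g" "E e f"
          "E e g" "E f g" "\<not> E a c" "\<not> E a d" "\<not> E a g" "\<not> E b e"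
          "\<not> E b f" "\<not> E c e" "\<not> E d f"
  shows "colorable E UNIV 4"
proof (rule ccontr)
  assume *: "\<not> colorable E UNIV 4"
  \<comment> \<open>On the five-cycle \<open>a b c d e\<close>, \<open>f\<close> sees
    \<open>a, c, e\<close> and \<open>g\<close> sees \<open>b, c, d, e\<close>. The chord
    \<open>b d\<close> is excluded by \<open>k4\<close> on \<open>b, c, d, g\<close>.\<close>
  let ?p = "\<lambda>w. if E w c \<and> E w d then False else if \<not> E w b \<and> \<not> E w f then False else
      True"
  let ?q = "\<lambda>w. if E w c \<and> E w d then False else if \<not> E w b \<and> \<not> E w f then True else
      if E w e then False else True"
  have "?p u \<noteq> ?p v \<or> ?q u \<noteq> ?q v" if "E u v" for u v
    using * that assms
      gem[of u a e g c v] gem[of v a e g c u] gem[of b u v g c a] gem[of b v u g c a]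
      gem[of e u v a f d] gem[of e v u a f d] gem[of e v u f a d] gem[of e v u g d a]
      gem[of e a f g d u] gem[of e a f g d v] gem[of f u v a e c] gem[of f u v c g a]
      gem[of f v u a e c] gem[of f v u c g a] gem[of g u v e f b] gem[of g v u e f b]
      gem[of g b c f e u] gem[of g b c f e v] two[of u v a e] two[of u v a f] two[of u v c g]
      two[of u v d e] two[of u a c d] two[of u a c g] two[of u a d g] two[of u b e f]
      two[of u c a e] two[of u d a f] two[of u e b c] two[of v a c d] two[of v a c g]
      two[of v a d g] two[of v b e f] two[of v c a e] two[of v d a f] two[of v e b c]
      k4[of u v a e] k4[of u v a f] k4[of u v c d] k4[of u v c f] k4[of u b c g] k4[of u c f g]
      k4[of u d e g] k4[of v b c g] k4[of v c f g] k4[of v d e g] k4[of v e f g] commute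
    by (smt (verit))
  with * show False using colorable4_bits[of E ?p ?q] by blast
qed

text \<open>Adjacent vertices \<open>f\<close> and \<open>g\<close> each see the ends of one edge of
  the cycle \<open>a b c d e\<close> and its opposite vertex. Arguing by contradiction makes the
  previous configuration available as excluded.\<close>

lemma colorable_if_five_cycle_ext2:
  assumes "E a b" "E a e" "E a f" "E b c" "E b f" "E b g" "E c d" "E d e" "E d f" "E d g" "E e g"
          "E f g" "\<not> E a c" "\<not> E a d" "\<not> E a g" "\<not> E b d" "\<not> E b e"
          "\<not> E c e" "\<not> E c f" "\<not> E c g" "\<not> E e f"
  shows "colorable E UNIV 4"
proof (rule ccontr)
  assume *: "\<not> colorable E UNIV 4"
  let ?p = "\<lambda>w. if \<not> E w b \<and> \<not> E w e then False else if E w b \<and> E w f then False else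
      True"
  let ?q = "\<lambda>w. if \<not> E w b \<and> \<not> E w e then False else if E w b \<and> E w f then True else
      if \<not> E w d then False else True"
  have "?p u \<noteq> ?p v \<or> ?q u \<noteq> ?q v" if "E u v" for u v
    using * that assms
      colorable_if_five_cycle_ext1[of b c a f d u e]
      colorable_if_five_cycle_ext1[of b c a f d v e]
      colorable_if_five_cycle_ext1[of e a d g b u c]
      colorable_if_five_cycle_ext1[of e a d g b v c] gem[of u v a f g c] gem[of u v e g f c]
      gem[of u a f d c v] gem[of v u a f g c] gem[of v u e g f c] gem[of v a f d c u]
      gem[of b v u a f c] gem[of b v a f g c] gem[of d u v g f c] gem[of d u f g e c]
      gem[of d v f g e c] gem[of f u v d g a] gem[of f v u d g a] gem[of f a b g d u]
      gem[of f a b g d v] gem[of g u v d e b] gem[of g v u d e b] two[of u v a f] two[of u v b c]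
      two[of u v b f] two[of u v d e] two[of u v d f] two[of u v d g] two[of u a d g]
      two[of u b d e] two[of u c a e] two[of u c e g] two[of u c f g] two[of u d a b]
      two[of u e b c] two[of v a d g] two[of v b d e] two[of v c a e] two[of v c e g]
      two[of v c f g] two[of v d a b] two[of v e b c] k4[of u v d f] k4[of u v d g] k4[of u v e g]
      k4[of u a b f] k4[of u b f g] k4[of u d e g] k4[of v a b f] k4[of v b f g] k4[of v d e g]
      commute
    by (smt (verit))
  with * show False using colorable4_bits[of E ?p ?q] by blast
qed

text \<open>Only one vertex \<open>f\<close> sees the ends of a cycle edge, \<open>d e\<close>, and
  the opposite vertex \<open>b\<close>; both earlier configurations are now excluded.\<close>

lemma colorable_if_five_cycle_ext3:
  assumes "E a b" "E a e" "E b c" "E b f" "E c d" "E d e" "E d f" "E e f" "\<not> E a c"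
          "\<not> E a d" "\<not> E a f" "\<not> E b d" "\<not> E b e" "\<not> E c e"
          "\<not> E c f"
  shows "colorable E UNIV 4"
proof (rule ccontr)
  assume *: "\<not> colorable E UNIV 4"
  let ?p = "\<lambda>w. if E w d \<and> E w e then False else if \<not> E w c \<and> E w d then False else
      if \<not> E w a \<and> E w e then True else if E w f then True else False"
  let ?q = "\<lambda>w. if E w d \<and> E w e then False else if \<not> E w c \<and> E w d then True else
      if \<not> E w a \<and> E w e then False else True"
  have "?p u \<noteq> ?p v \<or> ?q u \<noteq> ?q v" if "E u v" for u v
    using * that assms
      colorable_if_five_cycle_ext2[of d c e u b v a]
      colorable_if_five_cycle_ext2[of d c e v b u a]
      colorable_if_five_cycle_ext1[of d c e f b u a]
      colorable_if_five_cycle_ext1[of d c e f b v a]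
      colorable_if_five_cycle_ext1[of e a d f b u c]
      colorable_if_five_cycle_ext1[of e a d f b v c] gem[of u a b f d v] gem[of v a b f d u]
      gem[of d u v f e c] gem[of d v u f e c] gem[of e u v f d a] gem[of e v u f d a]
      gem[of f u v d e b] gem[of f u v e d b] gem[of f v u d e b] gem[of f v u e d b]
      two[of u v a e] two[of u v b c] two[of u v d e] two[of u v d f] two[of u v e f]
      two[of u a c d] two[of u a d f] two[of u b d e] two[of u c a e] two[of u c e f]
      two[of v a c d] two[of v a d f] two[of v b d e] two[of v c a e] two[of v c e f]
      k4[of u v d e] k4[of u v d f] k4[of u v e f] commute
    by (smt (verit))
  with * show False using colorable4_bits[of E ?p ?q] by blast
qed

text \<open>The exclusion of the previous configuration is applied both to the given cycle and to
  cycles in which \<open>u\<close> or \<open>v\<close> replaces one of its vertices.\<close>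

lemma colorable_if_five_cycle:
  assumes "E a b" "E a e" "E b c" "E c d" "E d e" "\<not> E a c" "\<not> E a d" "\<not> E b d"
          "\<not> E b e" "\<not> E c e"
  shows "colorable E UNIV 4"
proof (rule ccontr)
  assume *: "\<not> colorable E UNIV 4"
  let ?p = "\<lambda>w. if E w d \<and> E w e then False else if \<not> E w c \<and> \<not> E w e then False else
      if \<not> E w a then True else if E w b then False else True"
  let ?q = "\<lambda>w. if E w d \<and> E w e then False else if \<not> E w c \<and> \<not> E w e then True else
      if \<not> E w a then False else if E w b then False else True"
  have "?p u \<noteq> ?p v \<or> ?q u \<noteq> ?q v" if "E u v" for u v
    using * that assms
      colorable_if_five_cycle_ext3[of a b e c u d] colorable_if_five_cycle_ext3[of a b e c v d]
      colorable_if_five_cycle_ext3[of a e b d u c] colorable_if_five_cycle_ext3[of a e b d v c]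
      colorable_if_five_cycle_ext3[of b a u e v d] colorable_if_five_cycle_ext3[of b a v e u d]
      colorable_if_five_cycle_ext3[of b a c e u d] colorable_if_five_cycle_ext3[of b a c e v d]
      colorable_if_five_cycle_ext3[of b c u d v e] colorable_if_five_cycle_ext3[of b c v d u e]
      colorable_if_five_cycle_ext3[of b c a d u e] colorable_if_five_cycle_ext3[of b c a d v e]
      colorable_if_five_cycle_ext3[of c d b e u a] colorable_if_five_cycle_ext3[of c d b e v a]
      two[of u v a b] two[of u v a e] two[of u v b c] two[of u v c d] two[of u v d e]
      two[of u a c d] two[of u b d e] two[of u c a e] two[of u d a b] two[of u e b c]
      two[of v a c d] two[of v b d e] two[of v c a e] two[of v d a b] two[of v e b c]
      k4[of u v a b] k4[of u v a e] k4[of u v b c] k4[of u v c d] k4[of u v d e] commute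
    by (smt (z3))
  with * show False using colorable4_bits[of E ?p ?q] by blast
qed

text \<open>The configuration is the house: the triangle \<open>a b c\<close> on the four-cycle
  \<open>a b e d\<close>. Induced five-cycles are already excluded.\<close>

lemma colorable_if_triangle_ext:
  assumes "E a b" "E a c" "E a d" "E b c" "E b e" "E d e" "\<not> E a e" "\<not> E b d"
          "\<not> E c d" "\<not> E c e"
  shows "colorable E UNIV 4"
proof (rule ccontr)
  assume *: "\<not> colorable E UNIV 4"
  let ?p = "\<lambda>w. if E w a \<and> E w b then False else if E w d \<and> E w e then False else
      if E w a then True else if E w b then True else False"
  let ?q = "\<lambda>w. if E w a \<and> E w b then False else if E w d \<and> E w e then True else
      if E w a then False else True"
  have "?p u \<noteq> ?p v \<or> ?q u \<noteq> ?q v" if "E u v" for u v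
    using * that assms
      colorable_if_five_cycle[of u c e a d] colorable_if_five_cycle[of u c d b e]
      colorable_if_five_cycle[of v c e a d] colorable_if_five_cycle[of v c d b e]
      gem[of u c a d e v] gem[of u c b e d v] gem[of v c a d e u] gem[of v c b e d u]
      gem[of a u v c b d] gem[of a v u c b d] gem[of b u v c a e] gem[of b v u c a e]
      two[of u v a b] two[of u v a c] two[of u v b c] two[of u c d e] two[of u d b c]
      two[of u e a c] two[of v c d e] two[of v d b c] two[of v e a c] k4[of u v a b]
      k4[of u v a c] k4[of u v b c] k4[of u v d e] commute
    by (smt (verit))
  with * show False using colorable4_bits[of E ?p ?q] by blast
qed

text \<open>One class consists of the vertices with at most one neighbour in the triangle, and each
  pair of triangle vertices gives a class of vertices that see this pair. An edge in the first class
  gives a \<open>2K\<^sub>2\<close> or a house, an edge in another class a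
  \<open>K\<^sub>4\<close>.\<close>

lemma colorable_if_triangle:
  assumes "E a b" "E a c" "E b c"
  shows "colorable E UNIV 4"
proof (rule ccontr)
  assume *: "\<not> colorable E UNIV 4"
  let ?p = "\<lambda>w. if \<not> E w a \<and> \<not> E w c then False else
      if \<not> E w a \<and> E w b then False else if \<not> E w a then False else
      if E w b then True else if \<not> E w c then False else True"
  let ?q = "\<lambda>w. if \<not> E w a \<and> \<not> E w c then False else
      if \<not> E w a \<and> E w b then True else if \<not> E w a then False else
      if E w b then False else if \<not> E w c then False else True"
  have "?p u \<noteq> ?p v \<or> ?q u \<noteq> ?q v" if "E u v" for u v
    using * that assms
      colorable_if_triangle_ext[of a b c u v] colorable_if_triangle_ext[of a b c v u]
      colorable_if_triangle_ext[of a c b u v] colorable_if_triangle_ext[of a c b v u]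
      colorable_if_triangle_ext[of b c a u v] colorable_if_triangle_ext[of b c a v u]
      two[of u v a b] two[of u v a c] two[of u v b c] k4[of u v a b] k4[of u v a c] k4[of u v b c]
      commute
    by (smt (z3))
  with * show False using colorable4_bits[of E ?p ?q] by blast
qed

end

section \<open>Colour bounds for \<open>2K\<^sub>2\<close>-free vertex sets\<close>

context ugraph
begin

lemma no_edge_if_no_induced_matching:
  assumes "\<not> induced_matching E V 1" "u \<in> V" "v \<in> V"
  shows "\<not> E u v"
proof
  assume "E u v"
  then have "induced_matching E V 1"
    unfolding induced_matching_def using assms(2,3)
    by (intro exI[of _ "\<lambda>_. u"] exI[of _ "\<lambda>_. v"]) auto
  then show False using assms(1) by simp
qed

lemma induced_matching_2I:
  assumes "a \<in> V" "b \<in> V" "c \<in> V" "d \<in> V" "E a b" "E c d"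
    "\<not> E a c" "\<not> E a d" "\<not> E b c" "\<not> E b d"
  shows "induced_matching E V 2"
proof -
  have "\<not> E c a" "\<not> E d a" "\<not> E c b" "\<not> E d b" using assms sym by blast+
  then show ?thesis
    unfolding induced_matching_def using assms
    by (intro exI[of _ "\<lambda>i. if i = 0 then a else c"] exI[of _ "\<lambda>i. if i = 0 then b else d"])
      (auto simp: less_2_cases_iff)
qed

text \<open>Dropping the edges not inside \<open>V\<close> isolates all other vertices, so the
  hypotheses hold on the whole type.\<close>

lemma two_K2_K4_gem_plus_free_restrict:
  assumes "\<not> induced_matching E V 2" "gem_plus_free E V" "cliques_le E V 3"
  shows "two_K2_K4_gem_plus_free (\<lambda>u v. E u v \<and> u \<in> V \<and> v \<in> V)"
proof
  fix x y a b c d e f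
  let ?E = "\<lambda>u v. E u v \<and> u \<in> V \<and> v \<in> V"
  show "?E x y \<longleftrightarrow> ?E y x" using sym by blast
  show "\<not> ?E a b \<or> \<not> ?E a c \<or> \<not> ?E a d \<or> \<not> ?E b c \<or> \<not> ?E b d \<or> \<not> ?E c d"
  proof (rule ccontr)
    assume *: "\<not> ?thesis"
    then have "pairwise E {a, b, c, d}" using sym by (auto simp: pairwise_insert)
    then have "card {a, b, c, d} \<le> 3" using * assms(3) unfolding cliques_le_def by simp
    moreover have "card {a, b, c, d} = 4" using * irrefl by (subst card_insert_disjoint; auto)+
    ultimately show False by simp
  qed
  show "\<not> ?E a b \<or> ?E a c \<or> ?E a d \<or> ?E b c \<or> ?E b d \<or> \<not> ?E c d"
    using induced_matching_2I[of a V b c d] assms(1) by blast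
  show "\<not> ?E a b \<or> \<not> ?E a c \<or> \<not> ?E a d \<or> \<not> ?E a e \<or> \<not> ?E a f \<or> \<not> ?E b c \<or> ?E b d \<or> ?E b e \<or> ?E b f \<or>
      \<not> ?E c d \<or> ?E c e \<or> ?E c f \<or> \<not> ?E d e \<or> ?E d f \<or> ?E e f"
  proof (rule ccontr)
    assume *: "\<not> ?thesis"
    then have "P4_plus_K1_free E {w \<in> V. E a w}" "f \<in> {w \<in> V. E a w}"
      using assms(2) unfolding gem_plus_free_def by blast+
    then have "P4_free E {w \<in> {w \<in> V. E a w}. \<not> E f w}" unfolding P4_plus_K1_free_def by blast
    moreover have "{b, c, d, e} \<subseteq> {w \<in> {w \<in> V. E a w}. \<not> E f w}" using * sym[of f] by blast
    ultimately have "P4_free E {b, c, d, e}" by (rule P4_free_subset)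
    then show False using * unfolding P4_free_def by simp
  qed
qed

lemma colorable_of_restrict:
  assumes "colorable (\<lambda>u v. E u v \<and> u \<in> V \<and> v \<in> V) UNIV k"
  shows "colorable E V k"
proof -
  obtain c where c: "\<forall>v. c v < k" "\<forall>u v. E u v \<and> u \<in> V \<and> v \<in> V \<longrightarrow> c u \<noteq> c v"
    using assms unfolding colorable_def by blast
  then show ?thesis unfolding colorable_def by (intro exI[of _ c]) blast
qed

text \<open>The common non-neighbours of an edge are stable and take one colour in the edge step;
  the sum is exactly the stated binomial coefficient.\<close>

lemma colorable_if_2K2_free:
  assumes "finite V" "\<not> induced_matching E V 2" "gem_plus_free E V" "cliques_le E V (Suc (Suc m))"
  shows "colorable E V (Suc (Suc (Suc m)) choose 2)"
proof (cases "\<exists>u \<in> V. \<exists>v \<in> V. E u v")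
  case True
  then obtain u v where uv: "u \<in> V" "v \<in> V" "E u v" by blast
  let ?H = "{w \<in> V. \<not> E u w \<and> \<not> E v w}"
  have "\<not> induced_matching E ?H 1"
    using induced_matching_Suc[OF uv] assms(2) by (metis Suc_1)
  then have "colorable E ?H 1" using no_edge_if_no_induced_matching by (intro colorable_stable) blast
  from colorable_edge_step[OF assms(1,3,4) uv this] show ?thesis by (simp add: numeral_2_eq_2 ac_simps)
next
  case False
  then have "colorable E V 1" by (intro colorable_stable) blast
  then show ?thesis by (rule colorable_mono) (auto simp: numeral_2_eq_2)
qed

text \<open>The general bound would give six colours. A triangle leads to the configurations above;
  without one the cliques have at most two vertices and three colours suffice.\<close>

lemma colorable_4_if_2K2_free:
  assumes "finite V" "\<not> induced_matching E V 2" "gem_plus_free E V" "cliques_le E V 3"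
  shows "colorable E V 4"
proof (cases "\<exists>a \<in> V. \<exists>b \<in> V. \<exists>c \<in> V. E a b \<and> E a c \<and> E b c")
  case True
  then obtain a b c where abc: "a \<in> V" "b \<in> V" "c \<in> V" "E a b" "E a c" "E b c" by blast
  interpret R: two_K2_K4_gem_plus_free "\<lambda>u v. E u v \<and> u \<in> V \<and> v \<in> V"
    using two_K2_K4_gem_plus_free_restrict assms(2-4) .
  show ?thesis using abc R.colorable_if_triangle[of a b c] by (intro colorable_of_restrict) blast
next
  case False
  have "cliques_le E V 2"
    unfolding cliques_le_def
  proof (intro allI impI, rule ccontr)
    fix K assume K: "K \<subseteq> V" "pairwise E K" "\<not> card K \<le> 2"
    then obtain T where "T \<subseteq> K" "card T = 3" by (metis Suc_leI not_le numeral_2_eq_2 numeral_3_eq_3 obtain_subset_with_card_n)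
    then obtain a b c where "T = {a, b, c}" "a \<noteq> b" "a \<noteq> c" "b \<noteq> c" by (auto simp: card_3_iff)
    then have "E a b" "E a c" "E b c" "a \<in> V" "b \<in> V" "c \<in> V"
      using K(1,2) \<open>T \<subseteq> K\<close> by (auto simp: pairwise_def)
    then show False using False by blast
  qed
  then have "colorable E V 3" using colorable_if_2K2_free[of V 0] assms by (simp add: numeral_eq_Suc)
  then show ?thesis by (rule colorable_mono) auto
qed

end

section \<open>Triangle-free graphs without \<open>3K\<^sub>2\<close>\<close>

text \<open>The instance of \<open>tri\<close> with three equal vertices excludes loops.\<close>

locale K3_three_K2_free =
  fixes E :: "'a \<Rightarrow> 'a \<Rightarrow> bool"
  assumes commute: "E x y \<longleftrightarrow> E y x"
    and tri: "\<not> E x y \<or> \<not> E x z \<or> \<not> E y z"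
    and mat: "\<not> E a b \<or> E a c \<or> E a d \<or> E a e \<or> E a f \<or> E b c \<or> E b d \<or> E b e \<or> E b f \<or>
      \<not> E c d \<or> E c e \<or> E c f \<or> E d e \<or> E d f \<or> \<not> E e f"
begin

text \<open>As above, the five configurations are the output of a computer search; they cover all
  possible adjacencies in \<open>colorable_if_blocked_vertex\<close>.\<close>

lemma colorable_if_config1:
  assumes "E a d" "E a g" "E a j" "E b h" "E b i" "E c d" "E c h" "E d i" "E e f" "E e h" "E e i"
          "E e j" "E f g" "\<not> E a h" "\<not> E b f" "\<not> E b g" "\<not> E c f"
          "\<not> E c g" "\<not> E c j" "\<not> E d f" "\<not> E g h" "\<not> E g i"
  shows "colorable E UNIV 4"
proof (rule colorable4_bits)
  \<comment> \<open>Two five-cycles, \<open>a g f e j\<close> and \<open>b h c d i\<close>, linked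
    by \<open>a d\<close>, \<open>e h\<close> and \<open>e i\<close>.\<close>
  let ?p = "\<lambda>w. if E w g then False else if \<not> E w c \<and> E w i then False else
      if E w f \<and> E w h then False else if \<not> E w a \<and> \<not> E w c then True else
      if E w a \<and> E w c then True else if \<not> E w f then True else False"
  let ?q = "\<lambda>w. if E w g then False else if \<not> E w c \<and> E w i then True else
      if E w f \<and> E w h then True else if \<not> E w a \<and> \<not> E w c then False else
      True"
  show "?p u \<noteq> ?p v \<or> ?q u \<noteq> ?q v" if "E u v" for u v
    using that assms
      tri[of u v a] tri[of u v c] tri[of u v d] tri[of u v f] tri[of u v g] tri[of u v h]
      tri[of u v i] tri[of u a d] tri[of u a j] tri[of u b h] tri[of u b i] tri[of u c d]
      tri[of u c h] tri[of u d i] tri[of u e f] tri[of u e h] tri[of v a d] tri[of v a j]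
      tri[of v b h] tri[of v b i] tri[of v c d] tri[of v c h] tri[of v d i] tri[of v e f]
      tri[of v e h] tri[of a c d] tri[of a d g] tri[of a d i] tri[of a d j] tri[of a e j]
      tri[of a g j] tri[of b c h] tri[of b d i] tri[of b h i] tri[of c d h] tri[of c d i]
      tri[of c e h] tri[of d e i] tri[of e f g] tri[of e f h] tri[of e f i] tri[of e f j]
      mat[of u v a g c h] mat[of u v a g e i] mat[of u v b h f g] mat[of u v b i f g]
      mat[of u v c d e j] mat[of u v d i f g] mat[of u b c d f g] mat[of u c a g e i]
      mat[of u h d i f g] mat[of u i c h f g] mat[of u j c d f g] mat[of v b c d f g]
      mat[of v c a g e i] mat[of v h d i f g] mat[of v i c h f g] mat[of v j c d f g] commute
    by (smt (verit))
qed

text \<open>Five-cycles \<open>a b c d e\<close> and \<open>f g i h j\<close>, linked by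
  \<open>b i\<close>; the vertex \<open>k\<close> can replace \<open>j\<close>.\<close>

lemma colorable_if_config2:
  assumes "E a b" "E a e" "E b c" "E b i" "E c d" "E d e" "E f g" "E f j" "E f k" "E g i" "E h i"
          "E h j" "E h k" "\<not> E a f" "\<not> E a g" "\<not> E a h" "\<not> E a j"
          "\<not> E b f" "\<not> E b k" "\<not> E c f" "\<not> E c g" "\<not> E c h"
          "\<not> E c j" "\<not> E c k" "\<not> E d f" "\<not> E d g" "\<not> E d h"
          "\<not> E d i" "\<not> E d j" "\<not> E d k" "\<not> E e f" "\<not> E e g"
          "\<not> E e h" "\<not> E e j"
  shows "colorable E UNIV 4"
proof (rule colorable4_bits)
  let ?p = "\<lambda>w. if E w c then False else if E w f then False else True"
  let ?q = "\<lambda>w. if E w c then False else if E w f then True else if E w i then False else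
      if \<not> E w d then True else if \<not> E w h then False else True"
  show "?p u \<noteq> ?p v \<or> ?q u \<noteq> ?q v" if "E u v" for u v
    using that assms
      tri[of u v b] tri[of u v c] tri[of u v d] tri[of u v f] tri[of u v g] tri[of u v i]
      tri[of u v j] tri[of u v k] tri[of u a b] tri[of u d e] tri[of u g i] tri[of u h j]
      tri[of u h k] tri[of v a b] tri[of v d e] tri[of v g i] tri[of v h j] tri[of v h k]
      tri[of a b c] tri[of a b e] tri[of a d e] tri[of b c d] tri[of b c i] tri[of b g i]
      tri[of c d e] tri[of f g i] tri[of f g j] tri[of f h j] tri[of g h i] tri[of h i j]
      tri[of h i k] mat[of u v a e f g] mat[of u v a e f j] mat[of u v c d f j]
      mat[of u v c d h i] mat[of u a c d f g] mat[of u d b i f k] mat[of u e b c f g]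
      mat[of u g a e h j] mat[of u h a e f g] mat[of u h c d f g] mat[of u i c d f j]
      mat[of u i c d f k] mat[of u j c d g i] mat[of v a c d f g] mat[of v d b i f k]
      mat[of v e b c f g] mat[of v g a e h j] mat[of v h a e f g] mat[of v h c d f g]
      mat[of v i c d f j] mat[of v i c d f k] mat[of v j c d g i] commute
    by (smt (verit))
qed

text \<open>The cycles and \<open>k\<close> are as in the previous configuration, but the links are
  \<open>a k\<close>, \<open>d k\<close> and \<open>b j\<close>.\<close>

lemma colorable_if_config3:
  assumes "E a b" "E a e" "E a k" "E b c" "E b j" "E c d" "E d e" "E d k" "E f g" "E f j" "E f k"
          "E g i" "E h i" "E h j" "E h k" "\<not> E a g" "\<not> E a i" "\<not> E b g"
          "\<not> E c f" "\<not> E c g" "\<not> E c h" "\<not> E d g" "\<not> E d j"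
          "\<not> E e f" "\<not> E e g" "\<not> E e h" "\<not> E e i" "\<not> E e j"
  shows "colorable E UNIV 4"
proof (rule colorable4_bits)
  let ?p = "\<lambda>w. if E w f then False else if E w e \<and> \<not> E w h then False else
      if \<not> E w a \<and> \<not> E w i then True else if \<not> E w k then True else False"
  let ?q = "\<lambda>w. if E w f then False else if E w e \<and> \<not> E w h then True else
      if \<not> E w a \<and> \<not> E w i then False else True"
  show "?p u \<noteq> ?p v \<or> ?q u \<noteq> ?q v" if "E u v" for u v
    using that assms
      tri[of u v a] tri[of u v b] tri[of u v e] tri[of u v f] tri[of u v g] tri[of u v j]
      tri[of u v k] tri[of u a b] tri[of u a e] tri[of u a k] tri[of u b c] tri[of u b j]
      tri[of u c d] tri[of u d e] tri[of u g i] tri[of u h j] tri[of u h k] tri[of v a b]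
      tri[of v a e] tri[of v a k] tri[of v b c] tri[of v b j] tri[of v c d] tri[of v d e]
      tri[of v g i] tri[of v h j] tri[of v h k] tri[of a b c] tri[of a b j] tri[of a b k]
      tri[of a d e] tri[of a f k] tri[of a h k] tri[of b c d] tri[of b c j] tri[of b f j]
      tri[of b h j] tri[of c d e] tri[of c d k] tri[of d f k] tri[of d h k] tri[of f g i]
      tri[of f g j] tri[of f g k] tri[of f h j] tri[of g h i] tri[of h i j] tri[of h j k]
      mat[of u v a b f g] mat[of u v a e f j] mat[of u v a e h i] mat[of u v b c f k]
      mat[of u v c d f g] mat[of u v c d f j] mat[of u v d e f g] mat[of u c a e f g]
      mat[of u d a b f g] mat[of u g b j d k] mat[of u g c d h j] mat[of u h a b f g]
      mat[of u h a e f g] mat[of u h c d f g] mat[of u i a e f j] mat[of u j a e g i]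
      mat[of v c a e f g] mat[of v d a b f g] mat[of v g b j d k] mat[of v g c d h j]
      mat[of v h a b f g] mat[of v h a e f g] mat[of v h c d f g] mat[of v i a e f j]
      mat[of v j a e g i] commute
    by (smt (verit))
qed

text \<open>Five-cycles \<open>a b c d i\<close> and \<open>e f h g j\<close> linked by
  \<open>g i\<close>. Pairs such as \<open>a g\<close> and \<open>h i\<close> are non-adjacent by
  \<open>tri\<close>.\<close>

lemma colorable_if_config4:
  assumes "E a b" "E a i" "E b c" "E c d" "E d i" "E e f" "E e j" "E f h" "E g h" "E g i" "E g j"
          "\<not> E a e" "\<not> E a f" "\<not> E a h" "\<not> E a j" "\<not> E b e"
          "\<not> E b f" "\<not> E b g" "\<not> E b h" "\<not> E b j" "\<not> E c e"
          "\<not> E c f" "\<not> E c g" "\<not> E c h" "\<not> E c j" "\<not> E d e"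
          "\<not> E d f" "\<not> E d h" "\<not> E d j" "\<not> E f i"
  shows "colorable E UNIV 4"
proof (rule colorable4_bits)
  let ?p = "\<lambda>w. if E w b then False else if E w h then False else
      True"
  let ?q = "\<lambda>w. if E w b then False else if E w h then True else
      if \<not> E w f \<and> \<not> E w i then False else if \<not> E w d then True else False"
  show "?p u \<noteq> ?p v \<or> ?q u \<noteq> ?q v" if "E u v" for u v
    using that assms
      tri[of u v a] tri[of u v b] tri[of u v c] tri[of u v f] tri[of u v g] tri[of u v h]
      tri[of u v i] tri[of u a i] tri[of u c d] tri[of u d i] tri[of u e f] tri[of u g j]
      tri[of v a i] tri[of v c d] tri[of v d i] tri[of v e f] tri[of v g j] tri[of a b c]
      tri[of a b i] tri[of a d i] tri[of a g i] tri[of b c d] tri[of c d i] tri[of e f h]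
      tri[of e f j] tri[of e g j] tri[of f g h] tri[of g h i] tri[of g h j] mat[of u v a b e j]
      mat[of u v b c e j] mat[of u v b c f h] mat[of u v d i f h] mat[of u a c d e j]
      mat[of u c a i f h] mat[of u d a b e j] mat[of u d a b f h] mat[of u e a b g h]
      mat[of u f b c g i] mat[of u i b c f h] mat[of u j a b f h] mat[of v a c d e j]
      mat[of v c a i f h] mat[of v d a b e j] mat[of v d a b f h] mat[of v e a b g h]
      mat[of v f b c g i] mat[of v i b c f h] mat[of v j a b f h] commute
    by (smt (verit))
qed

text \<open>Five-cycles \<open>a b c d e\<close> and \<open>f g i h k\<close>; here \<open>l\<close>
  can replace \<open>k\<close>, and \<open>j\<close> is joined to \<open>b\<close> and
  \<open>h\<close>.\<close>

lemma colorable_if_config5: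
  assumes "E a b" "E a e" "E a l" "E b c" "E b i" "E b j" "E b k" "E c d" "E d e" "E d l" "E e k"
          "E f g" "E f k" "E f l" "E g i" "E h i" "E h j" "E h k" "E h l" "\<not> E a g"
          "\<not> E c g" "\<not> E c h" "\<not> E d g" "\<not> E e g" "\<not> E e i"
          "\<not> E e j" "\<not> E g j"
  shows "colorable E UNIV 4"
proof (rule colorable4_bits)
  let ?p = "\<lambda>w. if E w i then False else if E w a then False else if E w f then True else
      if E w l then True else if E w b then True else False"
  let ?q = "\<lambda>w. if E w i then False else if E w a then True else if E w f then False else
      if E w l then True else if E w b then False else True"
  show "?p u \<noteq> ?p v \<or> ?q u \<noteq> ?q v" if "E u v" for u v
    using that assms
      tri[of u v a] tri[of u v b] tri[of u v d] tri[of u v h] tri[of u v i] tri[of u v l]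
      tri[of u a b] tri[of u a e] tri[of u a l] tri[of u b c] tri[of u b j] tri[of u d e]
      tri[of u e k] tri[of u f g] tri[of u f k] tri[of u f l] tri[of u h k] tri[of v a b]
      tri[of v a e] tri[of v a l] tri[of v b c] tri[of v b j] tri[of v d e] tri[of v e k]
      tri[of v f g] tri[of v f k] tri[of v f l] tri[of v h k] tri[of a b c] tri[of a b i]
      tri[of a b j] tri[of a b k] tri[of a b l] tri[of a d l] tri[of a f l] tri[of a h l]
      tri[of b c d] tri[of b c i] tri[of b c k] tri[of b e k] tri[of b f k] tri[of b g i]
      tri[of b h j] tri[of c d e] tri[of c d l] tri[of d e k] tri[of d e l] tri[of d h l]
      tri[of e f k] tri[of e h k] tri[of f g i] tri[of f g k] tri[of f g l] tri[of f h l]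
      tri[of g h i] tri[of h i k] tri[of h i l] tri[of h k l] mat[of u v a l g i]
      mat[of u v b i f l] mat[of u v e k g i] mat[of u a c d h k] mat[of u c a e h i]
      mat[of u c a l g i] mat[of u c e k g i] mat[of u e b c h l] mat[of u f a e h i]
      mat[of u g a e h j] mat[of u g b c h l] mat[of u g b k d l] mat[of u g c d h k]
      mat[of u h a b f g] mat[of u k a l g i] mat[of v a c d h k] mat[of v c a e h i]
      mat[of v c a l g i] mat[of v c e k g i] mat[of v e b c h l] mat[of v f a e h i]
      mat[of v g a e h j] mat[of v g b c h l] mat[of v g b k d l] mat[of v g c d h k]
      mat[of v h a b f g] mat[of v k a l g i] commute
    by (smt (verit))
qed

text \<open>Besides \<open>c0 c1 c2 c3 c4\<close>, where \<open>d\<close> can replace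
  \<open>c1\<close>, there is the five-cycle \<open>x y t i p\<close>, where \<open>q\<close> or
  \<open>r\<close> can replace \<open>p\<close>. The adjacencies between the two cycles decide which
  configuration occurs.\<close>

lemma colorable_if_blocked_vertex:
  assumes "E c0 c1" "E c1 c2" "E c2 c3" "E c3 c4" "E c0 c4" "E c0 d" "E c2 d" "E x y" "E t i"
          "E p i" "E q i" "E r i" "E y t" "E x p" "E x q" "E x r" "E d p" "E c1 q" "E c4 q"
          "\<not> E x c0" "\<not> E x c1" "\<not> E x c2" "\<not> E x c3" "\<not> E x c4"
          "\<not> E x d" "\<not> E y c0" "\<not> E y c1" "\<not> E y c2" "\<not> E y c3"
          "\<not> E y c4" "\<not> E y d" "\<not> E i c0" "\<not> E i c1" "\<not> E i c2"
          "\<not> E i c3" "\<not> E i c4" "\<not> E i d" "\<not> E c4 p" "\<not> E c1 r"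
          "\<not> E d r"
  shows "colorable E UNIV 4"
proof (rule ccontr)
  assume "\<not> colorable E UNIV 4"
  then show False
    using assms
      colorable_if_config1[of p c3 x i c0 c1 c4 c2 t y]
      colorable_if_config1[of p c3 x i c1 c0 c2 c4 t y]
      colorable_if_config1[of p d x i c3 c4 c2 c0 t y]
      colorable_if_config1[of q x d c4 i t r y c3 c2]
      colorable_if_config1[of r c3 x i c0 d c4 c2 t y]
      colorable_if_config1[of r c2 x i c0 c4 d c3 t y]
      colorable_if_config1[of r c4 x i c2 d c3 c0 t y]
      colorable_if_config1[of r c0 x i c2 c3 c1 c4 t y]
      colorable_if_config1[of r x c2 c0 i t q y c4 c3]
      colorable_if_config1[of t c3 y i c0 c1 c4 c2 q x]
      colorable_if_config2[of c0 c1 c4 c2 t c3 x y p r i]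
      colorable_if_config2[of c0 c4 c1 c3 t c2 x y r p i]
      colorable_if_config2[of c0 c4 d c3 t c2 x y q p i]
      colorable_if_config3[of c2 d c3 r c0 p c4 x y t i]
      colorable_if_config3[of c3 c4 c2 p c0 q d x y t i]
      colorable_if_config3[of c3 c4 c2 p c0 r d x y t i]
      colorable_if_config3[of c4 c3 c0 q c2 p c1 x y t i]
      colorable_if_config3[of c4 c3 c0 q c2 r c1 x y t i]
      colorable_if_config3[of d c2 c0 q c3 r c4 x y t i]
      colorable_if_config4[of x y q t i c4 c3 c0 c2 d]
      colorable_if_config4[of y x t r i c4 c3 c0 c2 d]
      colorable_if_config4[of y x t r i d c0 c2 c4 c3]
      colorable_if_config5[of c0 c1 c4 r c2 t p q c3 x y i]
      colorable_if_config5[of c0 d c4 r c2 t p q c3 x y i]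
      colorable_if_config5[of c2 d c3 r c0 t q p c4 x y i]
      colorable_if_config5[of c3 c4 c2 p c0 t q r c1 x y i] mat[of c0 c4 c2 t x r]
      mat[of c0 d c3 t x r] mat[of c0 r c3 p y t] mat[of c0 t c2 c3 x q] mat[of c1 c2 c4 r y t]
      mat[of c1 c2 c4 t x r] mat[of c1 p c4 r y t] mat[of c1 q c3 p y t] mat[of c1 q c3 r d p]
      mat[of c1 q c3 r y t] mat[of c2 d c4 t x r] mat[of c2 r c4 q y t] mat[of c3 c4 d p y t]
      mat[of c3 c4 d t x r] mat[of c4 q d p y t] tri[of c0 c1 c2] tri[of c0 c1 c4] tri[of c0 c1 d]
      tri[of c0 c1 t] tri[of c0 c3 c4] tri[of c0 c4 d] tri[of c0 c4 q] tri[of c0 c4 r]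
      tri[of c0 d p] tri[of c1 c2 c3] tri[of c1 c2 q] tri[of c1 c2 t] tri[of c2 c3 c4]
      tri[of c2 c3 d] tri[of c2 d p] tri[of c2 d t] tri[of c3 c4 q] tri[of c3 c4 r]
      tri[of c3 c4 t] tri[of i p q] tri[of i p r] tri[of i q r] tri[of i t p] tri[of i t q]
      tri[of i t r] tri[of x y p] tri[of x y q] tri[of x y r] tri[of x y t] commute
    by (smt (verit))
qed

end

section \<open>Four-colouring around an edge \<open>x y\<close>\<close>

context K3_three_K2_free
begin

text \<open>Outside \<open>N(x) \<union> N(y)\<close> no two edges are independent, so an odd cycle there is a five-cycle.\<close>

lemma colorable_if_no_five_cycle_plus_edge:
  assumes xy: "E x y"
    and no: "\<And>a b c d e. E a b \<Longrightarrow> E b c \<Longrightarrow> E c d \<Longrightarrow> E d e \<Longrightarrow> E e a \<Longrightarrow>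
      \<forall>v \<in> {a, b, c, d, e}. \<not> E v x \<and> \<not> E v y \<Longrightarrow> False"
  shows "colorable E UNIV 4"
proof -
  let ?H = "\<lambda>v. \<not> E v x \<and> \<not> E v y"
  obtain p :: "'a \<Rightarrow> bool" where p: "\<And>u v. ?H u \<Longrightarrow> ?H v \<Longrightarrow> E u v \<Longrightarrow> p u \<noteq> p v"
  proof (cases "\<exists>a b. ?H a \<and> ?H b \<and> E a b")
    case True
    then obtain a b where ab: "?H a" "?H b" "E a b" by blast
    \<comment> \<open>Neighbours of \<open>a\<close> and of \<open>b\<close> go to different sides;
      any other vertex joins the side of \<open>N(b)\<close> exactly if it has a neighbour in
      \<open>?H\<close> adjacent to \<open>a\<close>. Every edge of \<open>?H\<close> meets
      \<open>N(a)\<close> or \<open>N(b)\<close>, and a failure would close a five-cycle through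
      \<open>a b\<close>.\<close>
    let ?w = "\<lambda>z. \<exists>w. ?H w \<and> E w a \<and> E z w"
    let ?p = "\<lambda>v. E v a \<or> \<not> E v b \<and> \<not> ?w v"
    have "?p u \<noteq> ?p v" if uv: "?H u" "?H v" "E u v" for u v
    proof -
      have vu: "E v u" using uv(3) commute[of u v] by blast
      have far: "E u a \<or> E u b \<or> E v a \<or> E v b"
        using mat[of u v a b x y] xy ab uv by blast
      have five: False if "?H z" "?H w" "?H w'" "E z w" "E z w'" "E w a" "E w' b" for z w w'
        using no[of a w z w' b] that ab commute[of a w] commute[of w z] commute[of b a] by blast
      have "\<not> (E u a \<and> E v a)" "\<not> (E u b \<and> E v b)" "\<not> (E u a \<and> E u b)" "\<not> (E v a \<and> E v b)"
        using tri[of u v a] tri[of u v b] tri[of u a b] tri[of v a b] ab uv by blast+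
      moreover have "?w v" if "E u a" using that uv vu by blast
      moreover have "?w u" if "E v a" using that uv by blast
      moreover have "\<not> ?w v" if "E u b" using five[of v _ u] that uv vu by blast
      moreover have "\<not> ?w u" if "E v b" using five[of u _ v] that uv by blast
      ultimately show ?thesis using far by argo
    qed
    then show thesis by (rule that[of ?p])
  next
    case False
    show thesis by (rule that[of "\<lambda>_. True"]) (use False in blast)
  qed
  \<comment> \<open>Two colours serve \<open>N(x)\<close> and \<open>N(y)\<close>, the other two the
    bipartite rest.\<close>
  let ?p = "\<lambda>v. E v x \<or> E v y" and ?q = "\<lambda>v. if E v x \<or> E v y then E v x else p v"
  show ?thesis
  proof (rule colorable4_bits)
    fix u v assume "E u v"
    then have "\<not> (E u x \<and> E v x)" "\<not> (E u y \<and> E v y)" "\<not> (E u x \<and> E u y)" "\<not> (E v x \<and> E v y)"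
      using tri[of u v x] tri[of u v y] tri[of u x y] tri[of v x y] xy by blast+
    then show "?p u \<noteq> ?p v \<or> ?q u \<noteq> ?q v" using p[of u v] \<open>E u v\<close> by auto
  qed
qed

text \<open>The vertices outside \<open>N(x) \<union> N(y)\<close> are those of a blow-up of the five-cycle, with classes
  \<open>S0\<close> to \<open>S4\<close>, and a stable set whose neighbours lie in \<open>N(x) \<union> N(y)\<close>. Giving \<open>S1\<close> the colour
  of \<open>N(x)\<close> and moving the neighbours of \<open>S1\<close> in \<open>N(x)\<close> to the other two colours can only
  fail at a vertex \<open>i\<close> of that stable set which sees all four colours.\<close>

lemma colorable_if_five_cycle_plus_edge:
  assumes cyc: "E c0 c1" "E c1 c2" "E c2 c3" "E c3 c4" "E c4 c0" and xy: "E x y"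
    and anti: "\<forall>v \<in> {c0, c1, c2, c3, c4}. \<not> E v x \<and> \<not> E v y"
  shows "colorable E UNIV 4"
proof -
  define H where "H v \<longleftrightarrow> \<not> E v x \<and> \<not> E v y" for v
  define S0 where "S0 v \<longleftrightarrow> H v \<and> E v c4 \<and> E v c1" for v
  define S1 where "S1 v \<longleftrightarrow> H v \<and> E v c0 \<and> E v c2" for v
  define S2 where "S2 v \<longleftrightarrow> H v \<and> E v c1 \<and> E v c3" for v
  define S3 where "S3 v \<longleftrightarrow> H v \<and> E v c2 \<and> E v c4" for v
  define S4 where "S4 v \<longleftrightarrow> H v \<and> E v c3 \<and> E v c0" for v
  define I where "I v \<longleftrightarrow> H v \<and> \<not> E v c0 \<and> \<not> E v c1 \<and> \<not> E v c2 \<and> \<not> E v c3 \<and> \<not> E v c4" for v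
  note S_defs = S0_def S1_def S2_def S3_def S4_def
  \<comment> \<open>\<open>R\<close>, \<open>P\<close> and \<open>Q\<close> partition
    \<open>N(x)\<close> by the presence of neighbours in \<open>S1\<close> and
    \<open>S4\<close>.\<close>
  define R where "R v \<longleftrightarrow> E v x \<and> (\<forall>s. S1 s \<longrightarrow> \<not> E v s)" for v
  define P where "P v \<longleftrightarrow> E v x \<and> (\<exists>s. S1 s \<and> E v s) \<and> (\<forall>s. S4 s \<longrightarrow> \<not> E v s)" for v
  define Q where "Q v \<longleftrightarrow> E v x \<and> (\<exists>s. S1 s \<and> E v s) \<and> (\<exists>s. S4 s \<and> E v s)" for v
  have anti': "\<not> E c0 x" "\<not> E c0 y" "\<not> E c1 x" "\<not> E c1 y" "\<not> E c2 x" "\<not> E c2 y"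
    "\<not> E c3 x" "\<not> E c3 y" "\<not> E c4 x" "\<not> E c4 y"
    using anti by auto
  have cyc': "E c1 c0" "E c2 c1" "E c3 c2" "E c4 c3" "E c0 c4"
    using cyc by (simp_all add: commute)
  have chord: "\<not> E c0 c2" "\<not> E c1 c3" "\<not> E c2 c4" "\<not> E c3 c0" "\<not> E c4 c1"
    "\<not> E c2 c0" "\<not> E c3 c1" "\<not> E c4 c2" "\<not> E c0 c3" "\<not> E c1 c4"
    using tri[of c1 c0 c2] tri[of c2 c1 c3] tri[of c3 c2 c4] tri[of c4 c3 c0] tri[of c0 c4 c1]
      tri[of c1 c2 c0] tri[of c2 c3 c1] tri[of c3 c4 c2] tri[of c4 c0 c3] tri[of c0 c1 c4]
      cyc cyc' by blast+
  have one_class: "\<not> (E v c0 \<and> E v c1)" "\<not> (E v c1 \<and> E v c2)" "\<not> (E v c2 \<and> E v c3)"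
    "\<not> (E v c3 \<and> E v c4)" "\<not> (E v c4 \<and> E v c0)" for v
    using tri[of v c0 c1] tri[of v c1 c2] tri[of v c2 c3] tri[of v c3 c4] tri[of v c4 c0] cyc by blast+
  \<comment> \<open>If \<open>c0\<close> were the only neighbour of \<open>v\<close> on the cycle,
    then \<open>v c0\<close>, \<open>c2 c3\<close> and \<open>x y\<close> would be an induced
    \<open>3K\<^sub>2\<close>.\<close>
  have H: "S0 v \<or> S1 v \<or> S2 v \<or> S3 v \<or> S4 v \<or> I v" if "H v" for v
    using that anti' cyc chord xy one_class[of v] mat[of v c0 c2 c3 x y] mat[of v c1 c3 c4 x y]
      mat[of v c2 c4 c0 x y] mat[of v c3 c0 c1 x y] mat[of v c4 c1 c2 x y]
    unfolding S_defs I_def H_def by argo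
  \<comment> \<open>If \<open>s\<close> and \<open>t\<close> were not adjacent, then
    \<open>x y\<close> and suitable edges from \<open>s\<close> and \<open>t\<close> to the cycle
    would form an induced \<open>3K\<^sub>2\<close>.\<close>
  have complete: "E s t" if "S1 s \<and> S2 t \<or> S0 s \<and> S1 t \<or> S3 s \<and> S4 t" for s t
    using that anti' cyc cyc' chord xy one_class[of s] one_class[of t] mat[of s c0 t c3 x y]
      mat[of s c4 t c2 x y] mat[of s c2 t c0 x y] commute[of c0 t] commute[of c4 t]
      commute[of c2 t]
    unfolding S_defs H_def by argo
  \<comment> \<open>Some cycle edge avoids all neighbours of \<open>v\<close>; together with
    \<open>i v\<close> and \<open>x y\<close> it would be an induced
    \<open>3K\<^sub>2\<close>.\<close>
  have IH: "\<not> E i v" if "I i" "H v" for i v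
    using that H[of v] anti' cyc chord xy one_class[of v] mat[of i v c0 c1 x y] mat[of i v c1 c2 x y]
      mat[of i v c2 c3 x y] mat[of i v c3 c4 x y] mat[of i v c4 c0 x y]
    unfolding S_defs I_def H_def by argo
  show ?thesis
  proof (cases "\<exists>i t r p q. I i \<and> E i t \<and> E i r \<and> E i p \<and> E i q \<and> E t y \<and> R r \<and> P p \<and> Q q")
    case True
    then obtain i t r p q where i: "I i" "E i t" "E i r" "E i p" "E i q" "E t y" "R r" "P p" "Q q"
      by blast
    obtain d where d: "S1 d" "E p d" using i(8) unfolding P_def by blast
    obtain s1 where s1: "S1 s1" "E q s1" using i(9) unfolding Q_def by blast
    obtain s4 where s4: "S4 s4" "E q s4" using i(9) unfolding Q_def by blast
    have H': "H s1" "H s4" "H d" using s1 s4 d unfolding S_defs by blast+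
    have *: "\<not> E r s1" "\<not> E r d" "\<not> E p s4" "E r x" "E p x" "E q x"
      using i(7-9) s1(1) s4(1) d(1) unfolding R_def P_def Q_def by blast+
    have pos: "E v u" if "E u v" for u v using that commute[of u v] by blast
    have neg: "\<not> E v u" if "\<not> E u v" for u v using that commute[of u v] by blast
    \<comment> \<open>Replacing \<open>c1\<close> by \<open>s1\<close> and \<open>c4\<close> by
      \<open>s4\<close> keeps the five-cycle and makes both new vertices neighbours of
      \<open>q\<close>.\<close>
    from H' i(1-6) d s1 s4 anti' cyc xy * IH[OF i(1) H'(1)] IH[OF i(1) H'(2)] IH[OF i(1) H'(3)]
    show ?thesis
      unfolding I_def S_defs H_def
      by - (elim conjE, rule colorable_if_blocked_vertex[of c0 s1 c2 c3 s4 d x y t i p q r];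
        (assumption | (rule pos, assumption) | (rule neg, assumption)))
  next
    case False
    \<comment> \<open>A vertex of \<open>I\<close> belongs to every class in which it has no
      neighbour from \<open>N(x)\<close> or \<open>N(y)\<close>. The classes may overlap, so
      \<open>?c\<close> takes the first that applies.\<close>
    define A where "A v \<longleftrightarrow> R v \<or> S1 v \<or> I v \<and> (\<forall>r. R r \<longrightarrow> \<not> E v r)" for v
    define B where "B v \<longleftrightarrow> E v y \<or> I v \<and> (\<forall>t. E t y \<longrightarrow> \<not> E v t)" for v
    define C where "C v \<longleftrightarrow> P v \<or> S2 v \<or> S4 v \<or> I v \<and> (\<forall>p. P p \<longrightarrow> \<not> E v p)" for v
    define D where "D v \<longleftrightarrow> Q v \<or> S3 v \<or> S0 v \<or> I v \<and> (\<forall>q. Q q \<longrightarrow> \<not> E v q)" for v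
    have cover: "A v \<or> B v \<or> C v \<or> D v" for v
    proof (cases "H v")
      case True
      then show ?thesis using H[of v] False unfolding A_def B_def C_def D_def by blast
    next
      case False
      then have "E v y \<or> R v \<or> P v \<or> Q v" unfolding H_def R_def P_def Q_def by blast
      then show ?thesis unfolding A_def B_def C_def D_def by blast
    qed
    have RS: "\<not> E u v" if "R u" "S1 v" for u v using that unfolding R_def by blast
    \<comment> \<open>\<open>P\<close> avoids \<open>S4\<close> by definition. It avoids
      \<open>S2\<close> because \<open>S1\<close> and \<open>S2\<close> are completely joined and a
      neighbour in both would give a triangle.\<close>
    have PS: "\<not> E u v" if hyp: "P u" "S2 v \<or> S4 v" for u v
    proof
      assume "E u v"
      obtain s where s: "S1 s" "E u s" using hyp(1) unfolding P_def by blast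
      have "S2 v" using hyp \<open>E u v\<close> unfolding P_def by blast
      then show False using complete[of s v] s \<open>E u v\<close> tri[of u s v] by blast
    qed
    \<comment> \<open>A vertex of \<open>Q\<close> has neighbours in \<open>S1\<close>, which is
      completely joined to \<open>S0\<close>, and in \<open>S4\<close>, which is completely joined
      to \<open>S3\<close>.\<close>
    have QS: "\<not> E u v" if hyp: "Q u" "S3 v \<or> S0 v" for u v
    proof
      assume "E u v"
      obtain s where s: "S1 s" "E u s" using hyp(1) unfolding Q_def by blast
      obtain s' where s': "S4 s'" "E u s'" using hyp(1) unfolding Q_def by blast
      have "E v s \<or> E v s'" using complete[of v s] complete[of v s'] hyp(2) s(1) s'(1) by blast
      then show False using s(2) s'(2) \<open>E u v\<close> tri[of u v s] tri[of u v s'] by blast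
    qed
    have stable: "\<not> (A u \<and> A v)" "\<not> (B u \<and> B v)" "\<not> (C u \<and> C v)" "\<not> (D u \<and> D v)"
      if uv: "E u v" for u v
    proof -
      have vu: "E v u" using uv commute[of u v] by blast
      have Y: "\<not> (E u y \<and> E v y)" using tri[of u v y] uv by blast
      have X: "\<not> ((R u \<or> P u \<or> Q u) \<and> (R v \<or> P v \<or> Q v))"
        using tri[of u v x] uv unfolding R_def P_def Q_def by blast
      \<comment> \<open>The sets sharing a colour have a common neighbour on the cycle:
        \<open>c0\<close>, \<open>c3\<close> and \<open>c4\<close> respectively.\<close>
      have S: "\<not> (S1 u \<and> S1 v)" "\<not> ((S2 u \<or> S4 u) \<and> (S2 v \<or> S4 v))"
        "\<not> ((S3 u \<or> S0 u) \<and> (S3 v \<or> S0 v))"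
        using tri[of u v c0] tri[of u v c3] tri[of u v c4] uv unfolding S_defs by blast+
      have I: "\<not> (I u \<and> H v)" "\<not> (H u \<and> I v)" using IH[of u v] IH[of v u] uv vu by blast+
      have SH: "H w" if "S0 w \<or> S1 w \<or> S2 w \<or> S3 w \<or> S4 w \<or> I w" for w
        using that unfolding S_defs I_def by blast
      show "\<not> (A u \<and> A v)"
        using X S(1) I SH[of u] SH[of v] RS[of u v] RS[of v u] uv vu unfolding A_def by blast
      show "\<not> (B u \<and> B v)" using Y I SH[of u] SH[of v] uv vu unfolding B_def by blast
      show "\<not> (C u \<and> C v)"
        using X S(2) I SH[of u] SH[of v] PS[of u v] PS[of v u] uv vu unfolding C_def by blast
      show "\<not> (D u \<and> D v)"
        using X S(3) I SH[of u] SH[of v] QS[of u v] QS[of v u] uv vu unfolding D_def by blast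
    qed
    let ?c = "\<lambda>v. if A v then 0 else if B v then 1 else if C v then 2 else (3::nat)"
    show ?thesis
      unfolding colorable_def
    proof (intro exI[of _ ?c] conjI ballI impI)
      show "?c v < 4" for v by simp
      show "?c u \<noteq> ?c v" if "E u v" for u v
        using stable[OF that] cover[of u] cover[of v] by auto
    qed
  qed
qed

lemma colorable_4: "colorable E UNIV 4"
proof (cases "\<exists>x y. E x y")
  case True
  then obtain x y where xy: "E x y" by blast
  show ?thesis
  proof (cases "\<exists>a b c d e. E a b \<and> E b c \<and> E c d \<and> E d e \<and> E e a \<and>
      (\<forall>v \<in> {a, b, c, d, e}. \<not> E v x \<and> \<not> E v y)")
    case True
    then obtain a b c d e where "E a b" "E b c" "E c d" "E d e" "E e a"
      "\<forall>v \<in> {a, b, c, d, e}. \<not> E v x \<and> \<not> E v y"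
      by (elim exE conjE)
    then show ?thesis using xy by (intro colorable_if_five_cycle_plus_edge[of a b c d e x y])
  next
    case False
    show ?thesis by (rule colorable_if_no_five_cycle_plus_edge[OF xy]) (use False in blast)
  qed
next
  case False
  then have "colorable E UNIV 1" by (intro colorable_stable) blast
  then show ?thesis by (rule colorable_mono) auto
qed

end

section \<open>The bound\<close>

context ugraph
begin

lemma K3_three_K2_free_restrict:
  assumes "\<not> induced_matching E V 3" "cliques_le E V 2"
  shows "K3_three_K2_free (\<lambda>u v. E u v \<and> u \<in> V \<and> v \<in> V)"
proof
  fix x y z a b c d e f
  let ?E = "\<lambda>u v. E u v \<and> u \<in> V \<and> v \<in> V"
  show "?E x y \<longleftrightarrow> ?E y x" using sym by blast
  show "\<not> ?E x y \<or> \<not> ?E x z \<or> \<not> ?E y z"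
  proof (rule ccontr)
    assume *: "\<not> ?thesis"
    then have "pairwise E {x, y, z}" using sym by (auto simp: pairwise_insert)
    then have "card {x, y, z} \<le> 2" using * assms(2) unfolding cliques_le_def by simp
    moreover have "card {x, y, z} = 3" using * irrefl by (subst card_insert_disjoint; auto)+
    ultimately show False by simp
  qed
  show "\<not> ?E a b \<or> ?E a c \<or> ?E a d \<or> ?E a e \<or> ?E a f \<or> ?E b c \<or> ?E b d \<or> ?E b e \<or> ?E b f \<or>
      \<not> ?E c d \<or> ?E c e \<or> ?E c f \<or> ?E d e \<or> ?E d f \<or> \<not> ?E e f"
  proof (rule ccontr)
    assume *: "\<not> ?thesis"
    let ?H = "{w \<in> V. \<not> E a w \<and> \<not> E b w}"
    have "induced_matching E ?H 2" by (rule induced_matching_2I[of c _ d e f]) (use * in blast)+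
    then have "induced_matching E V (Suc 2)" using * by (intro induced_matching_Suc[of a V b]) blast+
    then show False using assms(1) by simp
  qed
qed

lemma colorable_4_if_3K2_free:
  assumes "\<not> induced_matching E V 3" "cliques_le E V 2"
  shows "colorable E V 4"
  by (rule colorable_of_restrict, rule K3_three_K2_free.colorable_4, rule K3_three_K2_free_restrict[OF assms])

text \<open>Induction on \<open>p\<close> with \<open>m\<close> fixed, by the edge step; the pairs
  \<open>(p, m)\<close> where this is too weak use the four-colour results.\<close>

lemma colorable_chi_bound:
  assumes "2 \<le> p" "finite V" "\<not> induced_matching E V p" "gem_plus_free E V" "cliques_le E V m"
  shows "colorable E V (chi_bound p m)"
  using assms
proof (induction p arbitrary: V rule: less_induct)
  case (less p)
  have step: "colorable E V (chi_bound (p - 1) m + (Suc k choose 2) + 2 * Suc k)"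
    if p: "3 \<le> p" and m: "m = Suc (Suc k)" for k
  proof (cases "\<exists>u \<in> V. \<exists>v \<in> V. E u v")
    case True
    then obtain u v where uv: "u \<in> V" "v \<in> V" "E u v" by blast
    let ?H = "{w \<in> V. \<not> E u w \<and> \<not> E v w}"
    have "\<not> induced_matching E ?H (p - 1)"
      using induced_matching_Suc[OF uv, of "p - 1"] less.prems(3) p by auto
    moreover have "gem_plus_free E ?H" using less.prems(4) by (rule gem_plus_free_subset) auto
    moreover have "cliques_le E ?H m" using less.prems(5) by (rule cliques_le_subset) auto
    ultimately have "colorable E ?H (chi_bound (p - 1) m)" using less.IH[of "p - 1" ?H] less.prems(2) p by simp
    then show ?thesis using colorable_edge_step[of V k u v] less.prems uv m by simp
  next
    case False
    then have "colorable E V 1" by (intro colorable_stable) blast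
    then show ?thesis by (rule colorable_mono) auto
  qed
  consider "m = 0" | "m = 1" | "p = 2" "m = 2" | "p = 2" "m = 3" | "p = 2" "4 \<le> m"
    | "p = 3" "m = 2" | "4 \<le> p" "m = 2" | "3 \<le> p" "3 \<le> m"
    using less.prems(1) by linarith
  then show ?case
  proof cases
    \<comment> \<open>Here \<open>V\<close> is empty, which matches the value 0 of
      \<open>chi_bound\<close>.\<close>
    case 1
    then show ?thesis using less.prems(5) by (simp add: cliques_le_0 colorable_def)
  next
    case 2
    have "\<not> E u v" if "u \<in> V" "v \<in> V" for u v
    proof
      assume "E u v"
      then have "pairwise E {u, v}" "u \<noteq> v" using sym irrefl by (auto simp: pairwise_insert)
      moreover have "{u, v} \<subseteq> V" using that by blast
      ultimately have "card {u, v} \<le> 1" using less.prems(5) unfolding 2 cliques_le_def by blast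
      then show False using \<open>u \<noteq> v\<close> by simp
    qed
    then have "colorable E V 1" by (rule colorable_stable)
    then show ?thesis using 2 less.prems(1) chi_bound_eqs(1)[of p] by simp
  next
    case 3
    then have "colorable E V 3"
      using colorable_if_2K2_free[of V 0] less.prems by (simp add: numeral_eq_Suc)
    then show ?thesis using 3 by (simp add: chi_bound_eqs)
  next
    case 4
    then show ?thesis using colorable_4_if_2K2_free[of V] less.prems by (simp add: chi_bound_eqs)
  next
    case 5
    define k where "k = m - 2"
    have k: "m = Suc (Suc k)" using 5 by (simp add: k_def)
    then show ?thesis using colorable_if_2K2_free[of V k] less.prems 5 by (simp add: chi_bound_eqs)
  next
    \<comment> \<open>The edge step would only give 3 + 2 = 5 colours, one too many. From
      \<open>p = 4\<close> on, adding two colours is exact.\<close>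
    case 6
    then show ?thesis using colorable_4_if_3K2_free[of V] less.prems by (simp add: chi_bound_eqs)
  next
    case 7
    then have "colorable E V (chi_bound (p - 1) 2 + 2)" using step[of 0] by (simp add: numeral_2_eq_2)
    moreover have "chi_bound (p - 1) 2 + 2 = chi_bound p m"
      using 7 chi_bound_eqs(5)[of p] chi_bound_eqs(5)[of "p - 1"] by simp
    ultimately show ?thesis by simp
  next
    case 8
    define k where "k = m - 2"
    have k: "m = Suc (Suc k)" using 8 by (simp add: k_def)
    \<comment> \<open>The edge step adds one less than \<open>(m + 1) choose 2\<close>, so the
      recursion leaves \<open>m - 1\<close> colours to spare.\<close>
    have "chi_bound (p - 1) m + (Suc k choose 2) + 2 * Suc k \<le> chi_bound p m"
      using chi_bound_eqs(6)[OF 8(2,1)] k by (simp add: numeral_2_eq_2)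
    with step[OF 8(1) k] show ?thesis by (rule colorable_mono[OF _ order_refl])
  qed
qed

end

section \<open>Translation from forbidden induced subgraphs of a \<open>pair_graph\<close>\<close>

lemma not_induced_matching_if_free_of:
  assumes G: "pair_graph G" and "disjoint_edges p \<in> \<F>" and "free_of \<F> G"
    and \<F>: "\<And>F. F \<in> \<F> \<Longrightarrow> pair_graph F"
  shows "\<not> induced_matching (\<lambda>u v. (u, v) \<in> parcs G) (pverts G) p"
proof
  let ?E = "\<lambda>u v. (u, v) \<in> parcs G"
  interpret G: pair_graph G by (rule G)
  have sym: "?E u v \<longleftrightarrow> ?E v u" for u v using G.arcs_symmetric by blast
  have irrefl: "\<not> ?E u u" for u using G.no_loops' by blast
  assume "induced_matching ?E (pverts G) p"
  then obtain f g where fg: "\<forall>i<p. f i \<in> pverts G \<and> g i \<in> pverts G \<and> ?E (f i) (g i)"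
    "\<forall>i<p. \<forall>j<p. i \<noteq> j \<longrightarrow> \<not> ?E (f i) (f j) \<and> \<not> ?E (f i) (g j) \<and> \<not> ?E (g i) (f j) \<and> \<not> ?E (g i) (g j)"
    unfolding induced_matching_def by (elim exE conjE)
  let ?h = "\<lambda>n. if even n then f (n div 2) else g (n div 2)"
  let ?F = "disjoint_edges p"
  have adj: "?E (?h u) (?h v) \<longleftrightarrow> u div 2 = v div 2 \<and> u \<noteq> v" if "u < 2 * p" "v < 2 * p" for u v
  proof -
    have lt: "u div 2 < p" "v div 2 < p" using that by auto
    show ?thesis
    proof (cases "u div 2 = v div 2")
      case True
      then have "u \<noteq> v \<longleftrightarrow> even u \<noteq> even v" by presburger
      moreover have "?E (f (v div 2)) (g (v div 2))" "?E (g (v div 2)) (f (v div 2))"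
        using fg(1) lt sym[of "g (v div 2)"] by blast+
      ultimately show ?thesis using True irrefl by (cases "even u"; cases "even v") simp_all
    next
      case False
      then show ?thesis using fg(2) lt by simp
    qed
  qed
  have parcs: "(u, v) \<in> parcs ?F \<longleftrightarrow> u div 2 = v div 2 \<and> u \<noteq> v" if "u < 2 * p" "v < 2 * p" for u v
  proof
    assume "(u, v) \<in> parcs ?F"
    then show "u div 2 = v div 2 \<and> u \<noteq> v" by (auto simp: disjoint_edges_def symcl_def)
  next
    assume *: "u div 2 = v div 2 \<and> u \<noteq> v"
    define i where "i = u div 2"
    have "i < p" using that(1) by (simp add: i_def)
    then have i: "(2 * i, 2 * i + 1) \<in> (\<lambda>i. (2 * i, 2 * i + 1)) ` {..<p}" by simp
    then have i': "(2 * i + 1, 2 * i) \<in> (\<lambda>(a, b). (b, a)) ` (\<lambda>i. (2 * i, 2 * i + 1)) ` {..<p}"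
      by (rule image_eqI[rotated]) simp
    have "u = 2 * i \<and> v = 2 * i + 1 \<or> v = 2 * i \<and> u = 2 * i + 1"
      using * unfolding i_def by presburger
    then show "(u, v) \<in> parcs ?F"
      using i i' unfolding disjoint_edges_def symcl_def by (elim disjE conjE) simp_all
  qed
  have "inj_on ?h (pverts ?F)"
  proof (rule inj_onI, rule ccontr)
    fix u v assume uv: "u \<in> pverts ?F" "v \<in> pverts ?F" "?h u = ?h v" "u \<noteq> v"
    then have lt: "u < 2 * p" "v < 2 * p" by (auto simp: disjoint_edges_def)
    \<comment> \<open>\<open>w\<close> is the partner of \<open>u\<close>. If \<open>u\<close> and
      \<open>v\<close> had the same image, \<open>w\<close> would also be the partner of
      \<open>v\<close>, so \<open>u\<close> and \<open>v\<close> would form a pair and their common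
      image would carry a loop.\<close>
    obtain w where w: "w < 2 * p" "w div 2 = u div 2" "w \<noteq> u"
    proof
      let ?w = "if even u then u + 1 else u - 1"
      show "?w < 2 * p" "?w div 2 = u div 2" "?w \<noteq> u" using lt by (auto elim: oddE)
    qed
    then have "?E (?h u) (?h w)" using adj[of u w] lt by auto
    then have "?E (?h v) (?h w)" using uv(3) by simp
    then have "v div 2 = w div 2" using adj[of v w] lt w by blast
    then have "?E (?h u) (?h v)" using adj[of u v] lt w uv(4) by simp
    then show False using uv(3) irrefl by simp
  qed
  moreover have "?h ` pverts ?F \<subseteq> pverts G" using fg(1) by (auto simp: disjoint_edges_def)
  moreover have "\<forall>u \<in> pverts ?F. \<forall>v \<in> pverts ?F. ?E (?h u) (?h v) \<longleftrightarrow> (u, v) \<in> parcs ?F"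
    using adj parcs by (simp add: disjoint_edges_def)
  ultimately show False
    using free_of_iff_embedding[OF G \<F>, of \<F>] assms(2,3) by blast
qed

lemma gem_plus_free_if_free_of:
  assumes G: "pair_graph G" and "gem_plus \<in> \<F>" and "free_of \<F> G"
    and \<F>: "\<And>F. F \<in> \<F> \<Longrightarrow> pair_graph F"
  shows "gem_plus_free (\<lambda>u v. (u, v) \<in> parcs G) (pverts G)"
  unfolding gem_plus_free_def P4_plus_K1_free_def P4_free_def
proof (intro ballI impI, rule ccontr)
  let ?E = "\<lambda>u v. (u, v) \<in> parcs G"
  interpret G: pair_graph G by (rule G)
  have sym: "?E u v \<longleftrightarrow> ?E v u" for u v using G.arcs_symmetric by blast
  have irrefl: "\<not> ?E u u" for u using G.no_loops' by blast
  fix h e a b c d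
  assume V: "h \<in> pverts G" "e \<in> {w \<in> pverts G. ?E h w}"
    "a \<in> {w \<in> {w \<in> pverts G. ?E h w}. \<not> ?E e w}" "b \<in> {w \<in> {w \<in> pverts G. ?E h w}. \<not> ?E e w}"
    "c \<in> {w \<in> {w \<in> pverts G. ?E h w}. \<not> ?E e w}" "d \<in> {w \<in> {w \<in> pverts G. ?E h w}. \<not> ?E e w}"
    and path: "?E a b" "?E b c" "?E c d" "\<not> (?E a c \<or> ?E a d \<or> ?E b d)"
  \<comment> \<open>\<open>h\<close> is the dominating vertex, \<open>a b c d\<close> the path and
    \<open>e\<close> the pendant vertex.\<close>
  let ?f = "\<lambda>n::nat. if n = 0 then h else if n = 1 then a else if n = 2 then b else if n = 3 then c
    else if n = 4 then d else e"
  have adj: "?E h a" "?E h b" "?E h c" "?E h d" "?E h e" "\<not> ?E e a" "\<not> ?E e b" "\<not> ?E e c" "\<not> ?E e d"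
    using V by auto
  have sadj: "?E a h" "?E b h" "?E c h" "?E d h" "?E e h" "\<not> ?E a e" "\<not> ?E b e" "\<not> ?E c e" "\<not> ?E d e"
    "?E b a" "?E c b" "?E d c" "\<not> ?E c a" "\<not> ?E d a" "\<not> ?E d b"
    using adj path sym by blast+
  have ne: "h \<noteq> a" "h \<noteq> b" "h \<noteq> c" "h \<noteq> d" "h \<noteq> e" "a \<noteq> b" "a \<noteq> c" "a \<noteq> d" "a \<noteq> e"
    "b \<noteq> c" "b \<noteq> d" "b \<noteq> e" "c \<noteq> d" "c \<noteq> e" "d \<noteq> e"
    using adj sadj path irrefl by metis+
  have "inj_on ?f (pverts gem_plus)"
    using ne by (auto simp: gem_plus_def inj_on_def)
  moreover have "?f ` pverts gem_plus \<subseteq> pverts G"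
    using V by (auto simp: gem_plus_def)
  moreover have "\<forall>u \<in> pverts gem_plus. \<forall>v \<in> pverts gem_plus. ?E (?f u) (?f v) \<longleftrightarrow> (u, v) \<in> parcs gem_plus"
    using adj sadj path irrefl by (simp add: gem_plus_def symcl_def)
  ultimately show False
    using free_of_iff_embedding[OF G \<F>, of \<F>] assms(2,3) by blast
qed

lemma cliques_le_clique_number:
  assumes "pair_graph G"
  shows "cliques_le (\<lambda>u v. (u, v) \<in> parcs G) (pverts G) (clique_number G)"
proof -
  interpret G: pair_graph G by (rule assms)
  have "finite {K. is_clique G K}"
    by (rule finite_subset[of _ "Pow (pverts G)"]) (auto simp: is_clique_def)
  then have "card K \<le> Max (card ` {K. is_clique G K})" if "is_clique G K" for K
    using that by (intro Max_ge) auto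
  then show ?thesis unfolding cliques_le_def clique_number_def is_clique_def by blast
qed

lemma chromatic_number_le:
  assumes "pair_graph G" and "colorable (\<lambda>u v. (u, v) \<in> parcs G) (pverts G) k"
  shows "chromatic_number G \<le> k"
proof -
  interpret G: pair_graph G by (rule assms(1))
  obtain c where c: "\<forall>v \<in> pverts G. c v < k"
    "\<forall>u \<in> pverts G. \<forall>v \<in> pverts G. (u, v) \<in> parcs G \<longrightarrow> c u \<noteq> c v"
    using assms(2) unfolding colorable_def by blast
  have "proper_coloring G k c"
    unfolding proper_coloring_def using c G.wellformed' by (auto simp: image_subset_iff)
  then show ?thesis unfolding chromatic_number_def by (blast intro: Least_le)
qed

theorem theorem3p9:
  fixes p :: nat and G :: "'a pair_pre_digraph"
  assumes "2 \<le> p"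
    and "pair_graph G"
    and "free_of {disjoint_edges p, gem_plus} G"
  shows "chromatic_number G \<le> chi_bound p (clique_number G)"
proof -
  interpret G: pair_graph G by (rule assms(2))
  interpret ugraph "\<lambda>u v. (u, v) \<in> parcs G"
    by unfold_locales (use G.arcs_symmetric G.no_loops' in blast)+
  have F: "pair_graph F" if "F \<in> {disjoint_edges p, gem_plus}" for F
    using that pair_graph_disjoint_edges pair_graph_gem_plus by blast
  have "colorable (\<lambda>u v. (u, v) \<in> parcs G) (pverts G) (chi_bound p (clique_number G))"
    using assms(1) G.finite_verts
      not_induced_matching_if_free_of[OF assms(2) _ assms(3) F]
      gem_plus_free_if_free_of[OF assms(2) _ assms(3) F]
      cliques_le_clique_number[OF assms(2)]
    by (intro colorable_chi_bound) auto
  then show ?thesis by (rule chromatic_number_le[OF assms(2)])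
qed

end
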